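(* For any $\eta>0$ and any positive integer $d$, there exists some $k=k(d,\eta)$ with the following property. For all positive integers $n_1,\dots,n_d$, if $V\subset\mathcal G=\mathbb F_2^{n_1}\otimes\dots\otimes\mathbb F_2^{n_d}$ is a subspace which is $\eta$-closed, then $V$ contains a $k$-simple subspace; that is, $V\supset\bigcap_{I\subset[d],I\ne\emptyset}(H_I\otimes\mathbb F_2^{I^c})$ for some collection of subspaces $H_I\subset\mathbb F_2^I$ of codimension at most $k$.
   Context: A non-empty set $\mathcal A\subset\mathbb F_2^{n_1}\otimes\dots\otimes\mathbb F_2^{n_d}$ is $\eta$-closed if with probability at least $\eta$ we have $A+u_1\otimes\dots\otimes u_d\in\mathcal A$, when $A\in\mathcal A$ and vectors $u_i\in\mathbb F_2^{n_i}\setminus\{0\}$ are chosen independently and uniformly at random. For a non-empty $I\subset[d]=\{1,\dots,d\}$ write $\mathbb F_2^I=\bigotimes_{i\in I}\mathbb F_2^{n_i}$ and $I^c=[d]\setminus I$, so that $\mathcal G=\mathbb F_2^I\otimes\mathbb F_2^{I^c}$ naturally; $H_{[d]}\otimes\mathbb F_2^{\emptyset}$ means $H_{[d]}$. A set is $k$-simple if it is a translate of a set $\bigcap_{I\subset[d],I\ne\emptyset}(H_I\otimes\mathbb F_2^{I^c})$ with each $H_I\subset\mathbb F_2^I$ a subspace of codimension at most $k$. *)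

theory Defs
  imports
    "HOL-Probability.Probability"
    "HOL-Library.Z2"
    "HOL-Library.Function_Algebras"
begin

text \<open>
  The field \<open>F\<^sub>2\<close> is \<^typ>\<open>bit\<close>. A vector of \<open>F\<^sub>2\<^sup>m\<close> is a function \<^typ>\<open>nat \<Rightarrow> bit\<close> vanishing
  outside \<open>{..<m}\<close>. A tensor in \<open>\<Otimes>\<^sub>i\<^sub>\<in>\<^sub>I F\<^sub>2\<^bsup>n i\<^esup>\<close> is the array of its coordinates in the standard
  basis, i.e. a function on multi-indices \<open>x \<in> (\<Pi>\<^sub>E i\<in>I. {..<n i})\<close>, extended by \<open>0\<close>. For
  \<open>I = {}\<close> there is exactly one multi-index, so the empty tensor product is \<open>F\<^sub>2\<close>.
  Addition is the pointwise addition of \<^theory>\<open>HOL-Library.Function_Algebras\<close>.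
\<close>

definition bscale :: "bit \<Rightarrow> ('a \<Rightarrow> bit) \<Rightarrow> ('a \<Rightarrow> bit)" where
  "bscale c f = (\<lambda>x. c * f x)"

global_interpretation F2: vector_space "bscale :: bit \<Rightarrow> ('a \<Rightarrow> bit) \<Rightarrow> ('a \<Rightarrow> bit)"
  by unfold_locales (auto simp: bscale_def fun_eq_iff algebra_simps)

type_synonym tensor = "(nat \<Rightarrow> nat) \<Rightarrow> bit"

definition vecs :: "nat \<Rightarrow> (nat \<Rightarrow> bit) set" where
  "vecs m = {v. \<forall>j. j \<ge> m \<longrightarrow> v j = 0}"

definition indices :: "nat set \<Rightarrow> (nat \<Rightarrow> nat) \<Rightarrow> (nat \<Rightarrow> nat) set" where
  "indices I n = (\<Pi>\<^sub>E i\<in>I. {..<n i})"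

definition tensors :: "nat set \<Rightarrow> (nat \<Rightarrow> nat) \<Rightarrow> tensor set" where
  "tensors I n = {T. \<forall>x. x \<notin> indices I n \<longrightarrow> T x = 0}"

definition pure_tensor :: "nat set \<Rightarrow> (nat \<Rightarrow> nat) \<Rightarrow> (nat \<Rightarrow> nat \<Rightarrow> bit) \<Rightarrow> tensor" where
  "pure_tensor I n u = (\<lambda>x. if x \<in> indices I n then \<Prod>i\<in>I. u i (x i) else 0)"

text \<open>
  The product of \<open>S \<in> tensors I n\<close> and \<open>T \<in> tensors J n\<close> for disjoint \<open>I\<close>, \<open>J\<close>, as an element of
  \<open>tensors (I \<union> J) n\<close>. This is the natural identification \<open>F\<^sub>2\<^sup>I \<otimes> F\<^sub>2\<^sup>J = F\<^sub>2\<^bsup>I \<union> J\<^esup>\<close>.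
\<close>
definition tensor_prod ::
    "nat set \<Rightarrow> nat set \<Rightarrow> (nat \<Rightarrow> nat) \<Rightarrow> tensor \<Rightarrow> tensor \<Rightarrow> tensor" where
  "tensor_prod I J n S T =
     (\<lambda>x. if x \<in> indices (I \<union> J) n then S (restrict x I) * T (restrict x J) else 0)"

definition tensor_space_prod ::
    "nat set \<Rightarrow> nat set \<Rightarrow> (nat \<Rightarrow> nat) \<Rightarrow> tensor set \<Rightarrow> tensor set \<Rightarrow> tensor set" where
  "tensor_space_prod I J n H K = F2.span {tensor_prod I J n S T | S T. S \<in> H \<and> T \<in> K}"

definition eta_closed :: "real \<Rightarrow> nat \<Rightarrow> (nat \<Rightarrow> nat) \<Rightarrow> tensor set \<Rightarrow> bool" where
  "eta_closed \<eta> d n \<A> \<longleftrightarrow>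
     \<A> \<noteq> {} \<and> \<A> \<subseteq> tensors {1..d} n \<and>
     measure_pmf.prob
       (pair_pmf (pmf_of_set \<A>) (Pi_pmf {1..d} 0 (\<lambda>i. pmf_of_set (vecs (n i) - {0}))))
       {(A, u). A + pure_tensor {1..d} n u \<in> \<A>} \<ge> \<eta>"

text \<open>
  \<open>H I\<close> is a subspace of \<open>F\<^sub>2\<^sup>I\<close> of codimension at most \<open>k\<close>; values of \<open>H\<close> at other arguments are
  irrelevant.
\<close>
definition codim_family :: "nat \<Rightarrow> nat \<Rightarrow> (nat \<Rightarrow> nat) \<Rightarrow> (nat set \<Rightarrow> tensor set) \<Rightarrow> bool" where
  "codim_family k d n H \<longleftrightarrow>
     (\<forall>I. I \<subseteq> {1..d} \<and> I \<noteq> {} \<longrightarrow>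
        F2.subspace (H I) \<and> H I \<subseteq> tensors I n \<and>
        F2.dim (tensors I n) - F2.dim (H I) \<le> k)"

definition family_inter :: "nat \<Rightarrow> (nat \<Rightarrow> nat) \<Rightarrow> (nat set \<Rightarrow> tensor set) \<Rightarrow> tensor set" where
  "family_inter d n H =
     (\<Inter>I\<in>{I. I \<subseteq> {1..d} \<and> I \<noteq> {}}.
        tensor_space_prod I ({1..d} - I) n (H I) (tensors ({1..d} - I) n))"

definition k_simple :: "nat \<Rightarrow> nat \<Rightarrow> (nat \<Rightarrow> nat) \<Rightarrow> tensor set \<Rightarrow> bool" where
  "k_simple k d n W \<longleftrightarrow>
     (\<exists>H. \<exists>B\<in>tensors {1..d} n. codim_family k d n H \<and> W = (\<lambda>X. B + X) ` family_inter d n H)"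

end

theory Submission
  imports Defs
begin

text \<open>
  Let \<open>b\<^sub>0, \<dots>, b\<^sub>m\<^sub>-\<^sub>1\<close> enumerate the annihilator of \<open>V\<close>. That \<open>V\<close> is \<open>\<eta>\<close>-closed says that the
  \<open>(d + 1)\<close>-linear form \<open>T = \<Sum>\<^sub>l u\<^sub>0(l) \<cdot> b\<^sub>l(u\<^sub>1, \<dots>, u\<^sub>d)\<close> is biased, and a decomposition of \<open>T\<close> into few
  products \<open>f(u\<^sub>I) \<cdot> g(u\<^sub>J)\<close> with \<open>I \<union> J = {0, \<dots>, d}\<close> yields the subspaces \<open>H\<^sub>I\<close>: for \<open>0 \<notin> I\<close>, take the common
  kernel of the factors that depend on \<open>u\<^sub>I\<close>. So biased forms must be shown to have bounded partition
  rank, by induction on the number of variables.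

  Because of its bias, \<open>T\<close> agrees at most points with the majority vote over boundedly many
  derivatives \<open>T(x + y) + T(x)\<close>, hence with a function of boundedly many forms in fewer variables. By
  induction these can be refined to a family \<open>K\<close> in which no combination of forms of the same type is
  noticeably biased; such a family is equidistributed. Writing \<open>T(x)\<close> as the sum of \<open>T\<close> over the
  corners of a random box shows that \<open>T\<close> is nearly constant on every level set of \<open>K\<close>, with a value
  that is additive in each variable. Therefore \<open>T\<close> agrees at most points, and then everywhere, with a
  multilinear form that is a polynomial in the members of \<open>K\<close>.
\<close>

section \<open>Averages and multilinear forms\<close>

text \<open>All bounds must be independent of the groups \<open>E i\<close> and of the number m of
  annihilators, so every argument is about averages. Averaging over u_0 gives 1 if the pure tensor
  of u_1, ..., u_d lies in V and 0 otherwise; the bias of T is therefore the density of V among pure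
  tensors, and annihilators need not be chosen economically. The obstacle is circular: the
  equidistribution error has to be small against the mass \<open>(1 / 2) ^ card K\<close> of an
  atom, while making K regular enlarges K. Regularity is therefore demanded with a threshold that
  depends on the size of the refined family, and termination is measured by the sizes of the types
  instead of the number of forms. The induction hypothesis enters only here: an irregular
  combination is itself a biased form in fewer variables. Passing from agreement at most points to
  equality is a rigidity property: a multilinear form that is not identically zero equals 1 on a
  share of at least \<open>(1 / 2) ^ card V\<close> of the points, however large the groups
  are.\<close>

definition avg :: "'b set \<Rightarrow> ('b \<Rightarrow> real) \<Rightarrow> real" where
  "avg S f = (\<Sum>x\<in>S. f x) / real (card S)"

lemma avg_cong: "(\<And>x. x \<in> S \<Longrightarrow> f x = g x) \<Longrightarrow> avg S f = avg S g"
  by (simp add: avg_def)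

lemma avg_const: "finite S \<Longrightarrow> S \<noteq> {} \<Longrightarrow> avg S (\<lambda>_. c) = c"
  by (simp add: avg_def)

lemma avg_mono: "(\<And>x. x \<in> S \<Longrightarrow> f x \<le> g x) \<Longrightarrow> avg S f \<le> avg S g"
  by (simp add: avg_def divide_right_mono sum_mono)

lemma avg_nonneg: "(\<And>x. x \<in> S \<Longrightarrow> 0 \<le> f x) \<Longrightarrow> 0 \<le> avg S f"
  by (simp add: avg_def sum_nonneg)

lemma avg_add: "avg S (\<lambda>x. f x + g x) = avg S f + avg S g"
  by (simp add: avg_def sum.distrib add_divide_distrib)

lemma avg_diff: "avg S (\<lambda>x. f x - g x) = avg S f - avg S g"
  by (simp add: avg_def sum_subtractf diff_divide_distrib)

lemma avg_cmult: "avg S (\<lambda>x. c * f x) = c * avg S f"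
  by (simp add: avg_def sum_distrib_left)

lemma avg_multc: "avg S (\<lambda>x. f x * c) = avg S f * c"
  by (simp add: avg_def sum_distrib_right)

lemma avg_sum: "avg S (\<lambda>x. \<Sum>i\<in>I. f i x) = (\<Sum>i\<in>I. avg S (f i))"
  unfolding avg_def by (subst sum.swap) (simp add: sum_divide_distrib)

lemma avg_swap: "avg S (\<lambda>x. avg T (\<lambda>y. f x y)) = avg T (\<lambda>y. avg S (\<lambda>x. f x y))"
  unfolding avg_def sum_divide_distrib
  by (subst sum.swap) (simp add: ac_simps)

lemma avg_abs: "\<bar>avg S f\<bar> \<le> avg S (\<lambda>x. \<bar>f x\<bar>)"
  by (simp add: avg_def divide_right_mono sum_abs)

lemma avg_bij: "bij_betw h S S \<Longrightarrow> avg S (\<lambda>x. f (h x)) = avg S f"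
  unfolding avg_def using sum.reindex_bij_betw[of h S S f] by simp

lemma avg_le_bound:
  assumes "finite S" "S \<noteq> {}" "\<And>x. x \<in> S \<Longrightarrow> f x \<le> c"
  shows "avg S f \<le> c"
  using avg_mono[of S f "\<lambda>_. c"] assms by (simp add: avg_const)

lemma avg_exists_le:
  assumes "finite S" "S \<noteq> {}"
  shows "\<exists>x\<in>S. f x \<le> avg S f"
proof (rule ccontr)
  assume "\<not> ?thesis"
  then have "(\<Sum>x\<in>S. avg S f) < (\<Sum>x\<in>S. f x)"
    using assms by (intro sum_strict_mono) auto
  then show False using assms by (simp add: avg_def)
qed

lemma avg_square_le: "(avg S f)\<^sup>2 \<le> avg S (\<lambda>x. (f x)\<^sup>2)"
proof (cases "finite S \<and> S \<noteq> {}")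
  case True
  let ?m = "avg S f"
  have "0 \<le> avg S (\<lambda>x. (f x - ?m)\<^sup>2)" by (simp add: avg_nonneg)
  also have "\<dots> = avg S (\<lambda>x. (f x)\<^sup>2 - 2 * ?m * f x + ?m\<^sup>2)"
    by (simp add: power2_diff algebra_simps)
  also have "\<dots> = avg S (\<lambda>x. (f x)\<^sup>2) - 2 * ?m * ?m + ?m\<^sup>2"
    using True by (simp add: avg_add avg_diff avg_cmult avg_const)
  finally show ?thesis by (simp add: power2_eq_square)
qed (auto simp: avg_def)

text \<open>Cauchy-Schwarz iterated n times; powers of two suffice because the Gowers inequality
  squares once per variable.\<close>

lemma avg_power_le: "(avg S (\<lambda>x. \<bar>f x\<bar>)) ^ (2 ^ n) \<le> avg S (\<lambda>x. \<bar>f x\<bar> ^ (2 ^ n))"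
proof (induction n)
  case (Suc n)
  let ?g = "\<lambda>x. \<bar>f x\<bar> ^ (2 ^ n)"
  have "(avg S (\<lambda>x. \<bar>f x\<bar>)) ^ (2 ^ Suc n) = ((avg S (\<lambda>x. \<bar>f x\<bar>)) ^ (2 ^ n))\<^sup>2"
    by (simp add: power_mult[symmetric] mult.commute)
  also have "\<dots> \<le> (avg S ?g)\<^sup>2"
    using Suc by (intro power_mono) (auto intro!: zero_le_power avg_nonneg)
  also have "\<dots> \<le> avg S (\<lambda>x. (?g x)\<^sup>2)" by (rule avg_square_le)
  finally show ?case by (simp add: power_mult[symmetric] mult.commute)
qed simp

section \<open>Signs and multilinear forms over the two-element field\<close>

definition sg :: "bit \<Rightarrow> real" where "sg b = (if b = 0 then 1 else - 1)"

lemma sg_simps [simp]: "sg 0 = 1" "sg 1 = - 1"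
  by (simp_all add: sg_def)

lemma sg_add: "sg (a + b) = sg a * sg b"
  by (cases a; cases b) (simp_all add: sg_def)

lemma sg_sum: "sg (\<Sum>i\<in>I. f i) = (\<Prod>i\<in>I. sg (f i))"
proof (induction I rule: infinite_finite_induct)
  case (insert i I)
  then show ?case using sg_add[of "f i" "sum f I"] by simp
qed simp_all

lemma abs_sg [simp]: "\<bar>sg a\<bar> = 1"
  by (simp add: sg_def)

lemma sg_mult_self [simp]: "sg a * sg a = 1"
  by (simp add: sg_def)

lemma bit_add_self [simp]: "a + a = (0::bit)" "a + (a + b) = (b::bit)"
  by (cases a; cases b; simp)+

text \<open>The first clause lets forms of all types live on one function space, since f ignores the
  coordinates outside I. Over F_2 additivity is all of linearity; it is required on the whole type
  \<open>'a\<close>, not only on the subgroups used for averaging.\<close>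

definition mform :: "'i set \<Rightarrow> (('i \<Rightarrow> 'a::ab_group_add) \<Rightarrow> bit) \<Rightarrow> bool" where
  "mform I f \<longleftrightarrow> (\<forall>x y. (\<forall>i\<in>I. x i = y i) \<longrightarrow> f x = f y) \<and>
     (\<forall>i\<in>I. \<forall>x a b. f (x(i := a + b)) = f (x(i := a)) + f (x(i := b)))"

lemma mform_cong: "mform I f \<Longrightarrow> (\<And>i. i \<in> I \<Longrightarrow> x i = y i) \<Longrightarrow> f x = f y"
  by (auto simp: mform_def)

lemma mform_add: "mform I f \<Longrightarrow> i \<in> I \<Longrightarrow> f (x(i := a + b)) = f (x(i := a)) + f (x(i := b))"
  by (auto simp: mform_def)

lemma mform_sum:
  fixes f :: "'c \<Rightarrow> ('i \<Rightarrow> 'a::ab_group_add) \<Rightarrow> bit"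
  assumes "\<And>t. t \<in> C \<Longrightarrow> mform I (f t)"
  shows "mform I (\<lambda>x. \<Sum>t\<in>C. f t x)"
  unfolding mform_def
proof (intro conjI allI impI ballI)
  fix x y :: "'i \<Rightarrow> 'a" assume "\<forall>i\<in>I. x i = y i"
  then show "(\<Sum>t\<in>C. f t x) = (\<Sum>t\<in>C. f t y)"
    using assms by (intro sum.cong refl) (auto intro: mform_cong)
next
  fix i and x :: "'i \<Rightarrow> 'a" and a b :: 'a assume "i \<in> I"
  then show "(\<Sum>t\<in>C. f t (x(i := a + b))) = (\<Sum>t\<in>C. f t (x(i := a))) + (\<Sum>t\<in>C. f t (x(i := b)))"
    unfolding sum.distrib[symmetric] by (intro sum.cong refl mform_add[OF assms])
qed

lemma mform_override:
  fixes f :: "('i \<Rightarrow> 'a::ab_group_add) \<Rightarrow> bit"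
  assumes "mform J f" "I \<subseteq> J"
  shows "mform I (\<lambda>x. f (override_on y x I))"
  unfolding mform_def
proof (intro conjI allI impI ballI)
  fix x x' :: "'i \<Rightarrow> 'a" assume "\<forall>i\<in>I. x i = x' i"
  then have "override_on y x I = override_on y x' I" by (auto simp: override_on_def)
  then show "f (override_on y x I) = f (override_on y x' I)" by simp
next
  fix i and x :: "'i \<Rightarrow> 'a" and a b :: 'a assume i: "i \<in> I"
  have *: "override_on y (x(i := c)) I = (override_on y x I)(i := c)" for c
    using i by (auto simp: override_on_def)
  show "f (override_on y (x(i := a + b)) I) = f (override_on y (x(i := a)) I) + f (override_on y (x(i := b)) I)"
    unfolding * using i assms by (intro mform_add[OF assms(1)]) auto
qed

lemma mform_slice:
  fixes f :: "('i \<Rightarrow> 'a::ab_group_add) \<Rightarrow> bit"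
  assumes "mform (insert i J) f" "i \<notin> J"
  shows "mform J (\<lambda>w. f (w(i := h)))"
  unfolding mform_def
proof (intro conjI allI impI ballI)
  fix x y :: "'i \<Rightarrow> 'a" assume "\<forall>j\<in>J. x j = y j"
  then show "f (x(i := h)) = f (y(i := h))" by (intro mform_cong[OF assms(1)]) auto
next
  fix j and x :: "'i \<Rightarrow> 'a" and a b :: 'a assume j: "j \<in> J"
  with assms(2) have *: "x(j := c, i := h) = x(i := h, j := c)" for c by auto
  show "f (x(j := a + b, i := h)) = f (x(j := a, i := h)) + f (x(j := b, i := h))"
    unfolding * using j by (intro mform_add[OF assms(1)]) auto
qed

lemma mform_expand:
  assumes "mform V f" "finite A" "A \<subseteq> V"
  shows "f (override_on y (\<lambda>i. x i + y i) A) = (\<Sum>B\<in>Pow A. f (override_on y x B))"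
proof -
  \<comment> \<open>The base point is generalized to z because the induction step fixes coordinate i
    to \<open>x i\<close> or \<open>y i\<close> before the hypothesis is applied to A.\<close>
  have "f (override_on z (\<lambda>i. x i + y i) A) = (\<Sum>B\<in>Pow A. f (override_on (override_on z y A) x B))" for z
    using assms(2,3)
  proof (induction A arbitrary: z rule: finite_induct)
    case empty then show ?case by simp
  next
    case (insert i A)
    let ?s = "\<lambda>i. x i + y i"
    have inV: "i \<in> V" "A \<subseteq> V" using insert by auto
    have "f (override_on z ?s (insert i A)) = f ((override_on z ?s A)(i := x i + y i))"
      by (simp add: override_on_insert)
    also have "f ((override_on z ?s A)(i := x i + y i)) =
        f ((override_on z ?s A)(i := x i)) + f ((override_on z ?s A)(i := y i))"
      by (rule mform_add[OF assms(1) inV(1)])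
    also have "(override_on z ?s A)(i := x i) = override_on (z(i := x i)) ?s A"
      using insert.hyps by (auto simp: override_on_def)
    also have "(override_on z ?s A)(i := y i) = override_on (z(i := y i)) ?s A"
      using insert.hyps by (auto simp: override_on_def)
    also have "f (override_on (z(i := x i)) ?s A) = (\<Sum>B\<in>Pow A. f (override_on (override_on (z(i := x i)) y A) x B))"
      by (rule insert.IH[OF inV(2)])
    also have "\<dots> = (\<Sum>B\<in>Pow A. f (override_on (override_on z y (insert i A)) x (insert i B)))"
      using insert.hyps by (intro sum.cong refl arg_cong[where f = f]) (auto simp: override_on_def)
    also have "\<dots> = (\<Sum>B\<in>insert i ` Pow A. f (override_on (override_on z y (insert i A)) x B))"
      using insert.hyps by (subst sum.reindex) (auto simp: inj_on_def)
    also have "f (override_on (z(i := y i)) ?s A) = (\<Sum>B\<in>Pow A. f (override_on (override_on (z(i := y i)) y A) x B))"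
      by (rule insert.IH[OF inV(2)])
    also have "\<dots> = (\<Sum>B\<in>Pow A. f (override_on (override_on z y (insert i A)) x B))"
      using insert.hyps by (intro sum.cong refl arg_cong[where f = f]) (auto simp: override_on_def)
    also have "(\<Sum>B\<in>insert i ` Pow A. f (override_on (override_on z y (insert i A)) x B)) +
        (\<Sum>B\<in>Pow A. f (override_on (override_on z y (insert i A)) x B))
      = (\<Sum>B\<in>Pow (insert i A). f (override_on (override_on z y (insert i A)) x B))"
      unfolding Pow_insert using insert.hyps
      by (subst sum.union_disjoint) (auto simp: add.commute)
    finally show ?case .
  qed
  from this[of y] show ?thesis by (simp add: override_on_def)
qed

text \<open>In characteristic two the two occurrences of \<open>y i\<close> in each coordinate cancel.\<close>
lemma mform_corner_sum:
  assumes "mform V f" "finite A" "A \<subseteq> V"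
  shows "(\<Sum>S\<in>Pow A. f (override_on y (\<lambda>i. x i + y i) S)) = f (override_on y x A)"
proof -
  have "(\<Sum>S\<in>Pow A. f (override_on y (\<lambda>i. x i + y i) S)) = (\<Sum>S\<in>Pow A. \<Sum>B\<in>Pow S. f (override_on y x B))"
    using assms by (intro sum.cong refl mform_expand[OF assms(1)]) (auto intro: finite_subset)
  also have "\<dots> = (\<Sum>B\<in>Pow A. \<Sum>S\<in>{S\<in>Pow A. B \<subseteq> S}. f (override_on y x B))"
  proof -
    have "(\<Sum>S\<in>Pow A. \<Sum>B\<in>Pow S. f (override_on y x B)) = (\<Sum>S\<in>Pow A. \<Sum>B\<in>Pow A. if B \<subseteq> S then f (override_on y x B) else 0)"
    proof (rule sum.cong[OF refl])
      fix S assume "S \<in> Pow A"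
      then have "Pow S = {B\<in>Pow A. B \<subseteq> S}" by auto
      then show "(\<Sum>B\<in>Pow S. f (override_on y x B)) = (\<Sum>B\<in>Pow A. if B \<subseteq> S then f (override_on y x B) else 0)"
        using sum.inter_filter[of "Pow A" "\<lambda>B. f (override_on y x B)" "\<lambda>B. B \<subseteq> S"] assms(2) by simp
    qed
    also have "\<dots> = (\<Sum>B\<in>Pow A. \<Sum>S\<in>Pow A. if B \<subseteq> S then f (override_on y x B) else 0)"
      by (subst sum.swap) (rule refl)
    also have "\<dots> = (\<Sum>B\<in>Pow A. \<Sum>S\<in>{S\<in>Pow A. B \<subseteq> S}. f (override_on y x B))"
    proof (rule sum.cong[OF refl])
      fix B
      show "(\<Sum>S\<in>Pow A. if B \<subseteq> S then f (override_on y x B) else 0) = (\<Sum>S\<in>{S\<in>Pow A. B \<subseteq> S}. f (override_on y x B))"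
        using sum.inter_filter[of "Pow A" "\<lambda>_. f (override_on y x B)" "\<lambda>S. B \<subseteq> S"] assms(2) by simp
    qed
    finally show ?thesis .
  qed
  also have "\<dots> = (\<Sum>B\<in>Pow A. if B = A then f (override_on y x A) else 0)"
  proof (rule sum.cong[OF refl])
    fix B assume B: "B \<in> Pow A"
    have "(\<Sum>S\<in>{S\<in>Pow A. B \<subseteq> S}. f (override_on y x B)) = of_nat (card {S\<in>Pow A. B \<subseteq> S}) * f (override_on y x B)"
      by simp
    \<comment> \<open>This is even unless B = A, so in \<open>bit\<close> only B = A
      survives.\<close>
    also have "card {S\<in>Pow A. B \<subseteq> S} = 2 ^ card (A - B)"
    proof -
      have "bij_betw (\<lambda>C. B \<union> C) (Pow (A - B)) {S\<in>Pow A. B \<subseteq> S}"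
        using B by (intro bij_betwI[where g = "\<lambda>S. S - B"]) auto
      then show ?thesis using assms(2) by (auto simp: bij_betw_same_card[symmetric] card_Pow)
    qed
    also have "of_nat (2 ^ card (A - B)) * f (override_on y x B) = (if B = A then f (override_on y x A) else 0)"
      using B assms(2) by auto
    finally show "(\<Sum>S\<in>{S\<in>Pow A. B \<subseteq> S}. f (override_on y x B)) = (if B = A then f (override_on y x A) else 0)" .
  qed
  also have "\<dots> = f (override_on y x A)" using assms(2) by simp
  finally show ?thesis .
qed

section \<open>Gowers--Cauchy--Schwarz for multilinear forms\<close>

lemma sum_PiE_insert:
  assumes "i \<notin> J"
  shows "(\<Sum>x\<in>PiE (insert i J) E. F x) = (\<Sum>a\<in>E i. \<Sum>w\<in>PiE J E. F (w(i := a)))"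
proof -
  have "(\<Sum>x\<in>PiE (insert i J) E. F x) = (\<Sum>(a, w)\<in>E i \<times> PiE J E. F (w(i := a)))"
    unfolding PiE_insert_eq using inj_combinator[OF assms, of E]
    by (subst sum.reindex) (auto simp: o_def split_beta)
  then show ?thesis by (simp add: sum.cartesian_product)
qed

lemma avg_PiE_insert:
  assumes "i \<notin> J" "finite J"
  shows "avg (PiE (insert i J) E) F = avg (E i) (\<lambda>a. avg (PiE J E) (\<lambda>w. F (w(i := a))))"
proof -
  have "card (PiE (insert i J) E) = card (E i) * card (PiE J E)"
    using assms by (simp add: card_PiE)
  then show ?thesis
    by (simp add: avg_def sum_PiE_insert[OF assms(1)] sum_divide_distrib mult.commute)
qed

text \<open>\<open>E i\<close> is a finite subgroup; closure under negation follows from finiteness.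
  Taking subsets of one type lets the coordinates range over groups of different sizes, such as
  \<open>vecs (n i)\<close>.\<close>

locale coord_groups =
  fixes E :: "'i \<Rightarrow> 'a::ab_group_add set"
  assumes finite_E: "finite (E i)" and zero_E: "0 \<in> E i"
    and add_E: "a \<in> E i \<Longrightarrow> b \<in> E i \<Longrightarrow> a + b \<in> E i"
begin

lemma finite_PiE_E: "finite J \<Longrightarrow> finite (PiE J E)"
  by (simp add: finite_PiE finite_E)

lemma PiE_E_nonempty: "PiE J E \<noteq> {}"
  using zero_E by (auto simp: PiE_eq_empty_iff)

lemma E_nonempty: "E i \<noteq> {}"
  using zero_E by blast

lemma bij_shift: "h \<in> E i \<Longrightarrow> bij_betw (\<lambda>a. h + a) (E i) (E i)"
  by (rule bij_betw_imageI[OF _ endo_inj_surj]) (auto simp: inj_on_def finite_E add_E)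

text \<open>Orthogonality: translation by an h with \<open>g h = 1\<close> preserves the average and
  reverses its sign.\<close>

lemma avg_character:
  assumes g: "\<And>a b. g (a + b) = g a + (g b :: bit)"
  shows "avg (E i) (\<lambda>a. sg (g a)) = (if \<forall>a\<in>E i. g a = 0 then 1 else 0)"
proof (cases "\<forall>a\<in>E i. g a = 0")
  case True
  then have "avg (E i) (\<lambda>a. sg (g a)) = avg (E i) (\<lambda>a. 1)" by (intro avg_cong) simp
  then show ?thesis using True by (simp add: avg_const finite_E E_nonempty)
next
  case False
  then obtain h where h: "h \<in> E i" "g h = 1" by auto
  have "avg (E i) (\<lambda>a. sg (g a)) = avg (E i) (\<lambda>a. sg (g (h + a)))"
    using avg_bij[OF bij_shift[OF h(1)], of "\<lambda>a. sg (g a)"] by simp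
  also have "\<dots> = - avg (E i) (\<lambda>a. sg (g a))"
    using avg_cmult[of "E i" "-1" "\<lambda>a. sg (g a)"] by (simp only: g sg_add h(2)) simp
  finally show ?thesis using False by simp
qed

definition bias :: "'i set \<Rightarrow> (('i \<Rightarrow> 'a) \<Rightarrow> bit) \<Rightarrow> real" where
  "bias J f = avg (PiE J E) (\<lambda>x. sg (f x))"

text \<open>The factor \<open>b l\<close> misses the variable l, so a Cauchy-Schwarz step that
  doubles only this variable removes it. Multilinearity keeps the differences inside the class: the
  values of f at \<open>w(i := a)\<close> and \<open>w(i := a')\<close> add up to its value at
  \<open>w(i := a + a')\<close>. Hence the bound is the plain bias of f and no box norm is
  needed.\<close>

lemma gowers_cauchy_schwarz:
  assumes "finite J" "J \<noteq> {}" "mform J f"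
    and "\<And>l w. l \<in> J \<Longrightarrow> \<bar>b l w\<bar> \<le> 1"
    and "\<And>l w a. l \<in> J \<Longrightarrow> b l (w(l := a)) = b l w"
  shows "\<bar>avg (PiE J E) (\<lambda>w. sg (f w) * (\<Prod>l\<in>J. b l w))\<bar> ^ (2 ^ card J) \<le> bias J f"
  using assms
proof (induction J arbitrary: f b rule: finite_ne_induct)
  case (singleton i)
  \<comment> \<open>The only element of \<open>PiE {} E\<close>.\<close>
  define u where "u = (\<lambda>_::'i. undefined :: 'a)"
  have P: "avg (PiE {i} E) F = avg (E i) (\<lambda>a. F (u(i := a)))" for F
    using avg_PiE_insert[of i "{}" E F] by (simp add: avg_def u_def fun_upd_def)
  have add: "f (u(i := a + b)) = f (u(i := a)) + f (u(i := b))" for a b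
    by (rule mform_add[OF singleton(1)]) simp
  have bi: "b i (u(i := a)) = b i u" for a by (rule singleton(3)) simp
  have "avg (PiE {i} E) (\<lambda>w. sg (f w) * (\<Prod>l\<in>{i}. b l w)) = avg (E i) (\<lambda>a. sg (f (u(i := a)))) * b i u"
    unfolding P using bi by (simp add: avg_multc)
  moreover have "\<bar>b i u\<bar> \<le> 1" using singleton(2) by simp
  moreover have "avg (E i) (\<lambda>a. sg (f (u(i := a)))) \<in> {0, 1}"
    using avg_character[of "\<lambda>a. f (u(i := a))" i, OF add] by simp
  moreover have "bias {i} f = avg (E i) (\<lambda>a. sg (f (u(i := a))))" unfolding bias_def P ..
  ultimately show ?case by (auto simp: power_le_one_iff abs_mult abs_square_le_1)
next
  case (insert i J)
  define \<Omega> where "\<Omega> = PiE J E"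
  define g where "g = (\<lambda>a w. sg (f (w(i := a))) * (\<Prod>l\<in>J. b l (w(i := a))))"
  define H where "H = (\<lambda>a a'. avg \<Omega> (\<lambda>w. g a w * g a' w))"
  let ?A = "avg (PiE (insert i J) E) (\<lambda>w. sg (f w) * (\<Prod>l\<in>insert i J. b l w))"
  note fin = \<open>finite J\<close> and nin = \<open>i \<notin> J\<close>
  have bi: "b i (w(i := a)) = b i w" for w a by (rule insert.prems(3)) simp
  have "?A = avg (E i) (\<lambda>a. avg \<Omega> (\<lambda>w. b i w * g a w))"
    unfolding avg_PiE_insert[OF nin fin] \<Omega>_def[symmetric] g_def
    using fin nin by (intro avg_cong) (simp add: bi ac_simps)
  \<comment> \<open>\<open>b i\<close> is constant in coordinate i, so it leaves the inner average
    and is bounded by 1 after squaring.\<close>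
  also have "\<dots> = avg \<Omega> (\<lambda>w. b i w * avg (E i) (\<lambda>a. g a w))"
    by (subst avg_swap) (simp add: avg_cmult)
  finally have "?A\<^sup>2 \<le> avg \<Omega> (\<lambda>w. (b i w * avg (E i) (\<lambda>a. g a w))\<^sup>2)"
    using avg_square_le by metis
  also have "\<dots> \<le> avg \<Omega> (\<lambda>w. (avg (E i) (\<lambda>a. g a w))\<^sup>2)"
  proof (rule avg_mono)
    fix w
    have "(b i w)\<^sup>2 \<le> 1" using insert.prems(2)[of i w] by (simp add: abs_square_le_1)
    then show "(b i w * avg (E i) (\<lambda>a. g a w))\<^sup>2 \<le> (avg (E i) (\<lambda>a. g a w))\<^sup>2"
      by (simp add: power_mult_distrib mult_left_le_one_le)
  qed
  also have "\<dots> = avg \<Omega> (\<lambda>w. avg (E i) (\<lambda>a. avg (E i) (\<lambda>a'. g a w * g a' w)))"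
    by (simp add: power2_eq_square avg_cmult avg_multc)
  also have "\<dots> = avg (E i) (\<lambda>a. avg (E i) (\<lambda>a'. H a a'))"
    unfolding H_def by (subst avg_swap, subst avg_swap[of \<Omega>]) (rule refl)
  also have "\<dots> \<le> avg (E i) (\<lambda>a. avg (E i) (\<lambda>a'. \<bar>H a a'\<bar>))"
    by (intro avg_mono) simp
  finally have 1: "?A\<^sup>2 \<le> avg (E i) (\<lambda>a. \<bar>avg (E i) (\<lambda>a'. \<bar>H a a'\<bar>)\<bar>)"
    by (simp add: avg_nonneg)
  have H: "\<bar>H a a'\<bar> ^ (2 ^ card J) \<le> bias J (\<lambda>w. f (w(i := a + a')))" for a a'
  proof -
    have "H a a' = avg \<Omega> (\<lambda>w. sg (f (w(i := a + a'))) * (\<Prod>l\<in>J. b l (w(i := a)) * b l (w(i := a'))))"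
      unfolding H_def g_def mform_add[OF insert.prems(1) insertI1] sg_add prod.distrib
      by (rule avg_cong) (simp add: ac_simps)
    moreover have "\<bar>avg \<Omega> (\<lambda>w. sg (f (w(i := a + a'))) * (\<Prod>l\<in>J. b l (w(i := a)) * b l (w(i := a'))))\<bar> ^ (2 ^ card J)
      \<le> bias J (\<lambda>w. f (w(i := a + a')))"
      unfolding \<Omega>_def
    proof (rule insert.IH)
      show "mform J (\<lambda>w. f (w(i := a + a')))" by (rule mform_slice[OF insert.prems(1) nin])
      fix l w assume l: "l \<in> J"
      show "\<bar>b l (w(i := a)) * b l (w(i := a'))\<bar> \<le> 1"
        using insert.prems(2)[of l] l by (simp add: abs_mult mult_le_one)
      fix c
      from l nin have *: "w(l := c, i := e) = w(i := e, l := c)" for e by auto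
      have **: "b l (v(l := c)) = b l v" for v by (rule insert.prems(3)) (use l in simp)
      then show "b l (w(l := c, i := a)) * b l (w(l := c, i := a')) = b l (w(i := a)) * b l (w(i := a'))"
        by (simp only: * **)
    qed
    ultimately show ?thesis by simp
  qed
  have "\<bar>?A\<bar> ^ (2 ^ card (insert i J)) = (?A\<^sup>2) ^ (2 ^ card J)"
    using fin nin by (simp add: power_mult)
  also have "\<dots> \<le> (avg (E i) (\<lambda>a. \<bar>avg (E i) (\<lambda>a'. \<bar>H a a'\<bar>)\<bar>)) ^ (2 ^ card J)"
    by (intro power_mono 1) simp
  also have "\<dots> \<le> avg (E i) (\<lambda>a. \<bar>avg (E i) (\<lambda>a'. \<bar>H a a'\<bar>)\<bar> ^ (2 ^ card J))"
    by (rule avg_power_le)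
  also have "\<dots> \<le> avg (E i) (\<lambda>a. avg (E i) (\<lambda>a'. \<bar>H a a'\<bar> ^ (2 ^ card J)))"
    using avg_power_le by (intro avg_mono) (simp add: avg_nonneg)
  also have "\<dots> \<le> avg (E i) (\<lambda>a. avg (E i) (\<lambda>a'. bias J (\<lambda>w. f (w(i := a + a')))))"
    by (intro avg_mono H)
  \<comment> \<open>For fixed a, the sum h = a + a' is uniform on \<open>E i\<close>; the average
    over a becomes vacuous.\<close>
  also have "\<dots> = avg (E i) (\<lambda>a. avg (E i) (\<lambda>h. bias J (\<lambda>w. f (w(i := h)))))"
    by (rule avg_cong) (rule avg_bij[OF bij_shift])
  also have "\<dots> = bias (insert i J) f"
    by (simp add: avg_const finite_E E_nonempty bias_def avg_PiE_insert[OF nin fin])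
  finally show ?case .
qed

text \<open>Schwartz-Zippel for multilinear forms. Fix coordinate i at its value in a point where f
  is 1; wherever this slice is 1, the additive map in coordinate i is nonzero and takes the value 1
  exactly half of the time. So every variable costs a factor 1/2.\<close>

lemma mform_few_ones:
  assumes "finite V" "mform V f"
    and "avg (PiE V E) (\<lambda>x. of_bool (f x = 1)) < (1 / 2) ^ card V"
    and "x \<in> PiE V E"
  shows "f x = 0"
proof -
  have "(1 / 2) ^ card V \<le> avg (PiE V E) (\<lambda>x. of_bool (f x = 1))"
    if "x \<in> PiE V E" "f x = 1" for x
    using assms(1,2) that
  proof (induction V arbitrary: f x rule: finite_induct)
    case empty
    then show ?case by (simp add: avg_def)
  next
    case (insert i V)
    define g where "g = (\<lambda>w. f (w(i := x i)))"
    define w0 where "w0 = x(i := undefined)"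
    have "w0 \<in> PiE V E" using insert.prems(2) insert.hyps
      by (auto simp: w0_def PiE_def extensional_def)
    moreover have "g w0 = 1" using insert.prems by (simp add: g_def w0_def)
    moreover have "mform V g" unfolding g_def by (rule mform_slice) (use insert in auto)
    ultimately have "(1 / 2) ^ card V \<le> avg (PiE V E) (\<lambda>w. of_bool (g w = 1))"
      using insert.IH by blast
    then have "(1 / 2) ^ card (insert i V) \<le> avg (PiE V E) (\<lambda>w. of_bool (g w = 1) * (1 / 2))"
      unfolding avg_multc using insert.hyps by simp
    also have "\<dots> \<le> avg (PiE V E) (\<lambda>w. avg (E i) (\<lambda>a. of_bool (f (w(i := a)) = 1)))"
    proof (rule avg_mono)
      fix w assume "w \<in> PiE V E"
      have "avg (E i) (\<lambda>a. of_bool (f (w(i := a)) = 1)) = avg (E i) (\<lambda>a. 1 / 2 - 1 / 2 * sg (f (w(i := a))))"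
        by (rule avg_cong) (simp add: sg_def)
      also have "\<dots> = 1 / 2 - 1 / 2 * avg (E i) (\<lambda>a. sg (f (w(i := a))))"
        by (simp add: avg_diff avg_cmult[of _ "1/2", simplified] avg_const finite_E E_nonempty)
      also have "avg (E i) (\<lambda>a. sg (f (w(i := a)))) = (if \<forall>a\<in>E i. f (w(i := a)) = 0 then 1 else 0)"
        by (rule avg_character) (rule mform_add[OF insert.prems(1)], simp)
      finally have *: "avg (E i) (\<lambda>a. of_bool (f (w(i := a)) = 1)) = (1 / 2 - 1 / 2 * (if \<forall>a\<in>E i. f (w(i := a)) = 0 then 1 else 0) :: real)" .
      have "x i \<in> E i" using insert.prems by auto
      then have "g w = 1 \<Longrightarrow> \<not> (\<forall>a\<in>E i. f (w(i := a)) = 0)" by (auto simp: g_def)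
      then show "of_bool (g w = 1) * (1 / 2) \<le> avg (E i) (\<lambda>a. of_bool (f (w(i := a)) = 1) :: real)"
        unfolding * by auto
    qed
    also have "\<dots> = avg (PiE (insert i V) E) (\<lambda>x. of_bool (f x = 1))"
      using insert.hyps by (simp add: avg_PiE_insert avg_swap[of "E i"])
    finally show ?case .
  qed
  from this[of x] assms show ?thesis by force
qed

end

section \<open>Equidistribution of regular families of forms\<close>

declare add_bit_eq_xor [simp del] mult_bit_eq_and [simp del]

type_synonym ('i, 'a) typed_form = "'i set \<times> (('i \<Rightarrow> 'a) \<Rightarrow> bit)"

definition form_family :: "'i set \<Rightarrow> ('i, 'a::ab_group_add) typed_form set \<Rightarrow> bool" where
  "form_family V K \<longleftrightarrow> finite K \<and> (\<forall>p\<in>K. fst p \<subset> V \<and> fst p \<noteq> {} \<and> mform (fst p) (snd p))"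

text \<open>The joint value of the members of K at x, encoded as a subset of K. Level sets are
  thereby indexed by \<open>Pow K\<close>, and a function constant on level sets is a function of
  subsets.\<close>

definition atom :: "('i, 'a) typed_form set \<Rightarrow> ('i \<Rightarrow> 'a) \<Rightarrow> ('i, 'a) typed_form set" where
  "atom K x = {p \<in> K. snd p x = 1}"

text \<open>The pair (p, A) stands for p evaluated at x on A and at y elsewhere.
  \<open>A = fst p\<close> is left out because p at x is already recorded by
  \<open>atom K x\<close>; \<open>A = {}\<close>, which gives p at y, is kept.\<close>

definition mixed_terms :: "('i, 'a) typed_form set \<Rightarrow> (('i, 'a) typed_form \<times> 'i set) set" where
  "mixed_terms K = (SIGMA p:K. {A. A \<subset> fst p})"

definition mixed_value :: "('i, 'a) typed_form \<times> 'i set \<Rightarrow> ('i \<Rightarrow> 'a) \<Rightarrow> ('i \<Rightarrow> 'a) \<Rightarrow> bit" where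
  "mixed_value t x y = snd (fst t) (override_on y x (snd t))"

definition mixed_pattern where
  "mixed_pattern c x y = {t \<in> c. mixed_value t x y = 1}"

lemma atom_subset: "atom K x \<subseteq> K"
  by (auto simp: atom_def)

lemma mixed_pattern_subset: "mixed_pattern c x y \<subseteq> c"
  by (auto simp: mixed_pattern_def)

lemma finite_mixed_terms:
  assumes "finite V" "form_family V K"
  shows "finite (mixed_terms K)"
  unfolding mixed_terms_def
proof (rule finite_SigmaI)
  show "finite K" using assms by (simp add: form_family_def)
  fix p assume "p \<in> K"
  then have "finite (fst p)" using assms finite_subset unfolding form_family_def by blast
  then show "finite {A. A \<subset> fst p}" by (auto intro: finite_subset[of _ "Pow (fst p)"])
qed

lemma card_mixed_terms:
  assumes "finite V" "form_family V K"
  shows "card (mixed_terms K) \<le> card K * 2 ^ card V"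
proof -
  have K: "finite K" using assms by (simp add: form_family_def)
  have "mixed_terms K \<subseteq> K \<times> Pow V"
    using assms unfolding mixed_terms_def form_family_def by blast
  then have "card (mixed_terms K) \<le> card (K \<times> Pow V)"
    using K assms by (intro card_mono) auto
  then show ?thesis using assms by (simp add: card_cartesian_product card_Pow)
qed

context coord_groups
begin

definition regular :: "real \<Rightarrow> ('i, 'a) typed_form set \<Rightarrow> bool" where
  "regular \<phi> K \<longleftrightarrow> (\<forall>c I. c \<subseteq> K \<longrightarrow> c \<noteq> {} \<longrightarrow> (\<forall>p\<in>c. fst p = I) \<longrightarrow>
     bias I (\<lambda>x. \<Sum>p\<in>c. snd p x) \<le> \<phi>)"

text \<open>Exchanging the coordinates A of x and C of y with those of w is an involution of the
  triples (x, y, w), as A and C are disjoint. It supplies a fresh variable w for Cauchy-Schwarz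
  while x and y stay fixed.\<close>

lemma avg_resample2:
  assumes "finite V" "I \<subseteq> V" "A \<subseteq> I" "C \<subseteq> I" "A \<inter> C = {}"
  shows "avg (PiE V E) (\<lambda>x. avg (PiE V E) (\<lambda>y. avg (PiE I E) (\<lambda>w. F (override_on x w A) (override_on y w C))))
    = avg (PiE V E) (\<lambda>x. avg (PiE V E) (\<lambda>y. F x y))"
proof -
  have fin: "finite I" using assms finite_subset by blast
  let ?\<Omega> = "PiE V E" and ?W = "PiE I E"
  let ?h = "\<lambda>(x, y, w). (override_on x w A, override_on y w C, override_on (override_on w x A) y C)"
  have "(\<Sum>(x, y, w)\<in>?\<Omega> \<times> ?\<Omega> \<times> ?W. F (override_on x w A) (override_on y w C)) = (\<Sum>(x, y, w)\<in>?\<Omega> \<times> ?\<Omega> \<times> ?W. F x y)"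
    by (rule sum.reindex_bij_witness[where i = ?h and j = ?h])
      (use assms in \<open>auto simp: override_on_def fun_eq_iff PiE_def Pi_def extensional_def split: if_splits\<close>)
  then have "(\<Sum>x\<in>?\<Omega>. \<Sum>y\<in>?\<Omega>. \<Sum>w\<in>?W. F (override_on x w A) (override_on y w C)) = (\<Sum>x\<in>?\<Omega>. \<Sum>y\<in>?\<Omega>. F x y) * card ?W"
    by (simp add: sum.cartesian_product[symmetric] sum_distrib_left mult.commute)
  moreover have "card ?W > 0"
    using finite_PiE_E[OF fin] PiE_E_nonempty by (simp add: card_gt_0_iff)
  ultimately show ?thesis
    by (simp add: avg_def sum_divide_distrib[symmetric])
qed

text \<open>The Gowers--Cauchy--Schwarz inequality is applied in the variables of a form of largest
  type occurring in \<open>c\<close>; every other term, and \<open>u\<close>, omits one of these variables.\<close>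
lemma regular_character_bound:
  assumes V: "finite V" and K: "form_family V K" and reg: "regular (\<theta> ^ (2 ^ card V)) K"
    and \<theta>: "0 \<le> \<theta>" "\<theta> \<le> 1" and u: "\<And>x. \<bar>u x\<bar> \<le> 1"
    and c: "c \<subseteq> mixed_terms K" "c \<noteq> {}"
  shows "\<bar>avg (PiE V E) (\<lambda>x. avg (PiE V E) (\<lambda>y. u x * sg (\<Sum>t\<in>c. mixed_value t x y)))\<bar> \<le> \<theta>"
proof -
  let ?ty = "\<lambda>t. fst (fst t)"
  have finc: "finite c" using c finite_mixed_terms[OF V K] finite_subset by blast
  have "\<exists>t\<in>c. \<forall>s\<in>c. card (?ty s) \<le> card (?ty t)"
  proof -
    have "Max ((\<lambda>t. card (?ty t)) ` c) \<in> (\<lambda>t. card (?ty t)) ` c"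
      using finc c by (intro Max_in) auto
    then obtain t where "t \<in> c" "Max ((\<lambda>t. card (?ty t)) ` c) = card (?ty t)" by blast
    then show ?thesis using finc by (intro bexI[of _ t]) (auto intro!: Max_ge simp flip: \<open>_ = card (?ty t)\<close>)
  qed
  then obtain t0 where t0: "t0 \<in> c" "\<And>s. s \<in> c \<Longrightarrow> card (?ty s) \<le> card (?ty t0)" by blast
  define I A C where "I = ?ty t0" and "A = snd t0" and "C = I - A"
  have terms: "?ty t \<subset> V" "?ty t \<noteq> {}" "mform (?ty t) (snd (fst t))" "snd t \<subset> ?ty t" "fst t \<in> K" if "t \<in> c" for t
  proof -
    have "t \<in> mixed_terms K" using that c(1) by blast
    then have "fst t \<in> K" "snd t \<subset> ?ty t" by (auto simp: mixed_terms_def)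
    then show "?ty t \<subset> V" "?ty t \<noteq> {}" "mform (?ty t) (snd (fst t))" "snd t \<subset> ?ty t" "fst t \<in> K"
      using K unfolding form_family_def by blast+
  qed
  have I: "I \<subseteq> V" "I \<noteq> {}" "finite I" and A: "A \<subset> I"
    using terms[OF t0(1)] V finite_subset unfolding I_def A_def by blast+
  have C: "C \<noteq> {}" "C \<subseteq> I" "A \<inter> C = {}" using A by (auto simp: C_def)
  \<comment> \<open>After resampling, u sees w only in A, so it can be charged to any variable of
    C.\<close>
  then obtain l0 where l0: "l0 \<in> C" by blast
  \<comment> \<open>In the terms of c1 resampling replaces every argument by w; they add up to a
    form f of w alone, to which regularity applies.\<close>
  define c1 where "c1 = {t \<in> c. ?ty t = I \<and> snd t = A}"
  define c2 where "c2 = c - c1"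
  define f where "f = (\<lambda>w. \<Sum>t\<in>c1. snd (fst t) w)"
  have f: "mform I f" unfolding f_def
    by (rule mform_sum) (use terms in \<open>auto simp: c1_def\<close>)
  have bias_f: "bias I f \<le> \<theta> ^ (2 ^ card V)"
  proof -
    have "inj_on fst c1" by (auto simp: inj_on_def c1_def prod_eq_iff)
    then have "f = (\<lambda>x. \<Sum>p\<in>fst ` c1. snd p x)" by (simp add: f_def sum.reindex o_def)
    moreover have "t0 \<in> c1" using t0(1) by (simp add: c1_def I_def A_def)
    moreover have "fst ` c1 \<subseteq> K" "\<forall>p\<in>fst ` c1. fst p = I"
      using terms(5) by (auto simp: c1_def)
    ultimately show ?thesis using reg unfolding regular_def by (metis image_is_empty empty_iff)
  qed
  \<comment> \<open>A term that sees w on all of A through x and on all of C through y has a type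
    containing I. Maximality of \<open>card I\<close> makes the type equal to I, then the subset
    equals A, and the term belongs to c1.\<close>
  have "\<forall>t\<in>c2. \<exists>i\<in>I. (i \<in> A \<and> i \<notin> snd t) \<or> (i \<in> C \<and> i \<notin> ?ty t - snd t)"
  proof (intro ballI, rule ccontr)
    fix t assume t: "t \<in> c2" and "\<not> (\<exists>i\<in>I. (i \<in> A \<and> i \<notin> snd t) \<or> (i \<in> C \<and> i \<notin> ?ty t - snd t))"
    then have sub: "A \<subseteq> snd t" "C \<subseteq> ?ty t - snd t" using A C by auto
    have tc: "t \<in> c" using t by (simp add: c2_def)
    have "I \<subseteq> ?ty t" using sub terms(4)[OF tc] by (auto simp: C_def)
    moreover have "finite (?ty t)" using terms(1)[OF tc] V finite_subset by blast
    ultimately have eq: "?ty t = I" using t0(2)[OF tc] unfolding I_def by (metis card_seteq)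
    have "snd t = A" using sub terms(4)[OF tc] eq by (auto simp: C_def)
    then show False using t tc eq by (simp add: c2_def c1_def)
  qed
  then obtain \<iota> where \<iota>: "\<And>t. t \<in> c2 \<Longrightarrow> \<iota> t \<in> I"
    "\<And>t. t \<in> c2 \<Longrightarrow> (\<iota> t \<in> A \<and> \<iota> t \<notin> snd t) \<or> (\<iota> t \<in> C \<and> \<iota> t \<notin> ?ty t - snd t)"
    by metis
  have inner: "\<bar>avg (PiE I E) (\<lambda>w. u (override_on x w A) *
      sg (\<Sum>t\<in>c. mixed_value t (override_on x w A) (override_on y w C)))\<bar> \<le> \<theta>" for x y
  proof -
    define m where "m = (\<lambda>t w. sg (mixed_value t (override_on x w A) (override_on y w C)))"
    define b where "b = (\<lambda>l w. (if l = l0 then u (override_on x w A) else 1) * (\<Prod>t\<in>{t \<in> c2. \<iota> t = l}. m t w))"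
    have fin: "finite c1" "finite c2" using finc by (auto simp: c1_def c2_def)
    have eq: "u (override_on x w A) * sg (\<Sum>t\<in>c. mixed_value t (override_on x w A) (override_on y w C))
        = sg (f w) * (\<Prod>l\<in>I. b l w)" for w
    proof -
      have "(\<Sum>t\<in>c1. mixed_value t (override_on x w A) (override_on y w C)) = f w"
        unfolding f_def mixed_value_def
      proof (rule sum.cong[OF refl])
        fix t assume "t \<in> c1"
        then have t: "t \<in> c" "?ty t = I" "snd t = A" by (auto simp: c1_def)
        show "snd (fst t) (override_on (override_on y w C) (override_on x w A) (snd t)) = snd (fst t) w"
          by (rule mform_cong[OF terms(3)[OF t(1)]]) (use t in \<open>auto simp: override_on_def C_def\<close>)
      qed
      moreover have "c = c1 \<union> c2" "c1 \<inter> c2 = {}" by (auto simp: c1_def c2_def)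
      ultimately have "sg (\<Sum>t\<in>c. mixed_value t (override_on x w A) (override_on y w C)) = sg (f w) * (\<Prod>t\<in>c2. m t w)"
        using fin by (simp add: sum.union_disjoint sg_add sg_sum m_def)
      moreover have "(\<Prod>t\<in>c2. m t w) = (\<Prod>l\<in>I. \<Prod>t\<in>{t \<in> c2. \<iota> t = l}. m t w)"
        using fin I \<iota>(1) by (intro prod.group[symmetric]) auto
      moreover have "(\<Prod>l\<in>I. if l = l0 then u (override_on x w A) else 1) = u (override_on x w A)"
        using I l0 C by auto
      ultimately show ?thesis by (simp add: b_def prod.distrib)
    qed
    have "\<bar>avg (PiE I E) (\<lambda>w. sg (f w) * (\<Prod>l\<in>I. b l w))\<bar> ^ (2 ^ card I) \<le> bias I f"
    proof (rule gowers_cauchy_schwarz[OF I(3,2) f])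
      fix l w
      have "\<bar>\<Prod>t\<in>{t \<in> c2. \<iota> t = l}. m t w\<bar> = 1" by (simp add: abs_prod m_def)
      then show "\<bar>b l w\<bar> \<le> 1" using u by (simp add: b_def abs_mult)
      fix a
      have "l = l0 \<Longrightarrow> override_on x (w(l := a)) A = override_on x w A"
        using l0 by (auto simp: override_on_def C_def)
      moreover have "m t (w(l := a)) = m t w" if t: "t \<in> c2" "\<iota> t = l" for t
      proof -
        have "t \<in> c" using t by (simp add: c2_def)
        show ?thesis unfolding m_def mixed_value_def
          by (rule arg_cong[where f = sg], rule mform_cong[OF terms(3)[OF \<open>t \<in> c\<close>]])
            (use \<iota>(2)[OF t(1)] t(2) in \<open>auto simp: override_on_def C_def\<close>)
      qed
      ultimately show "b l (w(l := a)) = b l w"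
        unfolding b_def by (intro arg_cong2[where f = "(*)"] prod.cong) auto
    qed
    also have "\<dots> \<le> \<theta> ^ (2 ^ card V)" by (rule bias_f)
    also have "\<dots> \<le> \<theta> ^ (2 ^ card I)"
      using \<theta> I(1) V by (intro power_decreasing power_increasing card_mono) auto
    finally have "\<bar>avg (PiE I E) (\<lambda>w. sg (f w) * (\<Prod>l\<in>I. b l w))\<bar> \<le> \<theta>"
      using \<theta> by (simp add: power_mono_iff)
    then show ?thesis unfolding eq .
  qed
  have fin: "finite (PiE V E)" "PiE V E \<noteq> {}" using finite_PiE_E V PiE_E_nonempty by blast+
  have "avg (PiE V E) (\<lambda>x. avg (PiE V E) (\<lambda>y. u x * sg (\<Sum>t\<in>c. mixed_value t x y)))
    = avg (PiE V E) (\<lambda>x. avg (PiE V E) (\<lambda>y. avg (PiE I E) (\<lambda>w. u (override_on x w A) *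
      sg (\<Sum>t\<in>c. mixed_value t (override_on x w A) (override_on y w C)))))"
    using A by (intro avg_resample2[OF V I(1) _ C(2,3), symmetric]) auto
  also have "\<bar>\<dots>\<bar> \<le> \<theta>"
    by (intro order.trans[OF avg_abs] avg_le_bound[OF fin] inner)
  finally show ?thesis .
qed

text \<open>Fourier expansion of the indicator of a point: a product of factors (1 + s)/2 with signs
  s, multiplied out.\<close>

lemma of_bool_pattern:
  assumes "finite c" "r \<subseteq> c"
  shows "of_bool (mixed_pattern c x y = r) =
    (\<Sum>B\<in>Pow c. (1 / 2) ^ card c * (\<Prod>t\<in>B. if t \<in> r then - 1 else 1) * sg (\<Sum>t\<in>B. mixed_value t x y))"
proof -
  let ?e = "\<lambda>t. (if t \<in> r then - 1 else 1) * sg (mixed_value t x y)"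
  have e: "(1 + ?e t) / 2 = of_bool (t \<in> r \<longleftrightarrow> mixed_value t x y = 1)" for t
    by (simp add: sg_def)
  have "of_bool (mixed_pattern c x y = r) = (\<Prod>t\<in>c. of_bool (t \<in> r \<longleftrightarrow> mixed_value t x y = 1) :: real)"
  proof (cases "mixed_pattern c x y = r")
    case True
    then show ?thesis by (auto simp: mixed_pattern_def)
  next
    case False
    then obtain t where "t \<in> c" "\<not> (t \<in> r \<longleftrightarrow> mixed_value t x y = 1)"
      using assms(2) unfolding mixed_pattern_def by blast
    then have "(\<Prod>t\<in>c. of_bool (t \<in> r \<longleftrightarrow> mixed_value t x y = 1) :: real) = 0"
      using assms(1) by (intro prod_zero) auto
    then show ?thesis using False by simp
  qed
  also have "\<dots> = (\<Prod>t\<in>c. (1 + ?e t) / 2)" by (simp only: e)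
  also have "\<dots> = (1 / 2) ^ card c * (\<Prod>t\<in>c. ?e t + 1)"
    by (simp add: prod_dividef power_divide add.commute)
  also have "(\<Prod>t\<in>c. ?e t + 1) = (\<Sum>B\<in>Pow c. \<Prod>t\<in>B. ?e t)"
    using assms(1) by (simp add: prod_add)
  finally show ?thesis
    by (simp add: sum_distrib_left sg_sum prod.distrib mult.assoc)
qed

text \<open>The empty character gives the main term. Each of the fewer than
  \<open>2 ^ card c\<close> others has coefficient of modulus \<open>(1 / 2) ^ card c\<close> and
  average at most \<theta>, so the total error is \<theta> whatever the size of c. The arbitrary
  weight u expresses that the pattern is nearly independent of x.\<close>

lemma pattern_independent:
  assumes V: "finite V" and K: "form_family V K" and reg: "regular (\<theta> ^ (2 ^ card V)) K"
    and \<theta>: "0 \<le> \<theta>" "\<theta> \<le> 1" and u: "\<And>x. \<bar>u x\<bar> \<le> 1"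
    and c: "c \<subseteq> mixed_terms K" and r: "r \<subseteq> c"
  shows "\<bar>avg (PiE V E) (\<lambda>x. avg (PiE V E) (\<lambda>y. u x * of_bool (mixed_pattern c x y = r)))
    - (1 / 2) ^ card c * avg (PiE V E) u\<bar> \<le> \<theta>"
proof -
  let ?\<Omega> = "PiE V E"
  have fin: "finite ?\<Omega>" "?\<Omega> \<noteq> {}" using finite_PiE_E V PiE_E_nonempty by blast+
  have finc: "finite c" using c finite_mixed_terms[OF V K] finite_subset by blast
  define s :: "(('i, 'a) typed_form \<times> 'i set) set \<Rightarrow> real" where
    "s = (\<lambda>B. (1 / 2) ^ card c * (\<Prod>t\<in>B. if t \<in> r then - 1 else 1))"
  define G where "G = (\<lambda>B. avg ?\<Omega> (\<lambda>x. avg ?\<Omega> (\<lambda>y. u x * sg (\<Sum>t\<in>B. mixed_value t x y))))"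
  have s: "\<bar>s B\<bar> = (1 / 2) ^ card c" for B
    unfolding s_def abs_mult abs_prod by (simp add: if_distrib[of abs] power_abs cong: if_cong)
  have "avg ?\<Omega> (\<lambda>x. avg ?\<Omega> (\<lambda>y. u x * of_bool (mixed_pattern c x y = r)))
    = avg ?\<Omega> (\<lambda>x. avg ?\<Omega> (\<lambda>y. \<Sum>B\<in>Pow c. s B * (u x * sg (\<Sum>t\<in>B. mixed_value t x y))))"
    unfolding of_bool_pattern[OF finc r] s_def
    by (simp add: sum_distrib_left mult_ac)
  also have "\<dots> = (\<Sum>B\<in>Pow c. s B * G B)"
    unfolding avg_sum avg_cmult G_def ..
  also have "\<dots> = s {} * G {} + (\<Sum>B\<in>Pow c - {{}}. s B * G B)"
    using finc by (subst sum.remove[of _ "{}"]) auto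
  also have "s {} * G {} = (1 / 2) ^ card c * avg ?\<Omega> u"
    by (simp add: s_def G_def avg_const[OF fin])
  finally have "avg ?\<Omega> (\<lambda>x. avg ?\<Omega> (\<lambda>y. u x * of_bool (mixed_pattern c x y = r)))
      - (1 / 2) ^ card c * avg ?\<Omega> u = (\<Sum>B\<in>Pow c - {{}}. s B * G B)" by simp
  also have "\<bar>\<dots>\<bar> \<le> (\<Sum>B\<in>Pow c - {{}}. \<bar>s B * G B\<bar>)" by (rule sum_abs)
  also have "\<dots> \<le> (\<Sum>B\<in>Pow c - {{}}. (1 / 2) ^ card c * \<theta>)"
  proof (rule sum_mono)
    fix B assume "B \<in> Pow c - {{}}"
    then have "\<bar>G B\<bar> \<le> \<theta>" unfolding G_def
      using c by (intro regular_character_bound[OF V K reg \<theta> u]) auto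
    then show "\<bar>s B * G B\<bar> \<le> (1 / 2) ^ card c * \<theta>"
      by (simp add: abs_mult s)
  qed
  also have "\<dots> \<le> (\<Sum>B\<in>Pow c. (1 / 2) ^ card c * \<theta>)"
    using finc \<theta> by (intro sum_mono2) auto
  also have "\<dots> = \<theta>" using finc by (simp add: card_Pow power_divide)
  finally show ?thesis .
qed

end

section \<open>Approximations by functions of a regular family\<close>

lemma bit_eqI: "(a = 1 \<longleftrightarrow> b = 1) \<Longrightarrow> a = (b :: bit)"
  by (cases a; cases b) simp_all

context coord_groups
begin

lemma bij_corner:
  assumes "finite V" "x \<in> PiE V E" "S \<subseteq> V"
  shows "bij_betw (\<lambda>y. override_on y (\<lambda>i. x i + y i) S) (PiE V E) (PiE V E)"
proof (rule bij_betw_imageI)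
  let ?h = "\<lambda>y. override_on y (\<lambda>i. x i + y i) S"
  show inj: "inj_on ?h (PiE V E)"
  proof (rule inj_onI)
    fix y y' assume eq: "?h y = ?h y'"
    show "y = y'"
    proof
      fix i show "y i = y' i" using fun_cong[OF eq, of i] by (cases "i \<in> S") auto
    qed
  qed
  have "?h ` PiE V E \<subseteq> PiE V E"
    using assms(2,3) by (auto simp: PiE_def Pi_def extensional_def override_on_def add_E)
  then show "?h ` PiE V E = PiE V E"
    using inj finite_PiE_E[OF assms(1)] by (intro endo_inj_surj) auto
qed

text \<open>By multilinearity, p at a corner is a sum of mixed evaluations over subsets B of the
  type of p. The full subset is read off from \<open>atom K x\<close>, every other one from the
  mixed pattern.\<close>

lemma atom_corner_determined:
  fixes x y x' y' :: "'i \<Rightarrow> 'a"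
  assumes V: "finite V" and K: "form_family V K"
    and "atom K x = atom K x'" "mixed_pattern (mixed_terms K) x y = mixed_pattern (mixed_terms K) x' y'"
  shows "atom K (override_on y (\<lambda>i. x i + y i) S) = atom K (override_on y' (\<lambda>i. x' i + y' i) S)"
proof -
  have "snd p (override_on y (\<lambda>i. x i + y i) S) = snd p (override_on y' (\<lambda>i. x' i + y' i) S)" if p: "p \<in> K" for p
  proof -
    have m: "mform (fst p) (snd p)" and fin: "finite (fst p)"
      using p K V finite_subset unfolding form_family_def by blast+
    have *: "snd p (override_on v (\<lambda>i. u i + v i) S) = (\<Sum>B\<in>Pow (S \<inter> fst p). snd p (override_on v u B))" for u v :: "'i \<Rightarrow> 'a"
    proof -
      have "snd p (override_on v (\<lambda>i. u i + v i) S) = snd p (override_on v (\<lambda>i. u i + v i) (S \<inter> fst p))"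
        by (rule mform_cong[OF m]) (auto simp: override_on_def)
      then show ?thesis using mform_expand[OF m, of "S \<inter> fst p" v u] fin by simp
    qed
    have "snd p (override_on y x B) = snd p (override_on y' x' B)" if B: "B \<subseteq> fst p" for B :: "'i set"
    proof (cases "B = fst p")
      case True
      have "snd p (override_on v u B) = snd p u" for u v :: "'i \<Rightarrow> 'a"
        by (rule mform_cong[OF m]) (simp add: True)
      moreover have "snd p x = 1 \<longleftrightarrow> snd p x' = 1" using assms(3) p by (auto simp: atom_def)
      ultimately show ?thesis by (simp add: bit_eqI)
    next
      case False
      then have "(p, B) \<in> mixed_terms K" using p B by (auto simp: mixed_terms_def)
      then have "mixed_value (p, B) x y = 1 \<longleftrightarrow> mixed_value (p, B) x' y' = 1"
        using assms(4) by (auto simp: mixed_pattern_def)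
      then show ?thesis unfolding mixed_value_def fst_conv snd_conv by (rule bit_eqI)
    qed
    then show ?thesis unfolding * by (intro sum.cong refl) auto
  qed
  then show ?thesis unfolding atom_def by (intro Collect_cong conj_cong refl) simp
qed

text \<open>Since \<open>T x\<close> is the sum of the values of \<open>T\<close> at the \<open>2 ^ card V\<close> corners
  \<open>y i\<close> or \<open>x i + y i\<close>, each of them uniformly distributed for fixed \<open>x\<close>, an approximation of
  \<open>T\<close> that is good on average is good on every single atom.\<close>
lemma atom_correlation:
  assumes V: "finite V" and K: "form_family V K" and reg: "regular (\<theta> ^ (2 ^ card V)) K"
    and \<theta>: "0 \<le> \<theta>" "\<theta> \<le> 1" and T: "mform V T"
    and F: "\<And>x y. x \<in> PiE V E \<Longrightarrow> y \<in> PiE V E \<Longrightarrow> atom K x = atom K y \<Longrightarrow> F x = F y"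
    and err: "avg (PiE V E) (\<lambda>x. of_bool (F x \<noteq> T x)) \<le> \<epsilon>"
  shows "avg (PiE V E) (\<lambda>x. of_bool (atom K x = q)) * (1 - 2 * 2 ^ card V * \<epsilon>)
    \<le> \<bar>avg (PiE V E) (\<lambda>x. of_bool (atom K x = q) * sg (T x))\<bar> + 2 ^ card (mixed_terms K) * \<theta>"
proof -
  let ?\<Omega> = "PiE V E" and ?c = "mixed_terms K"
  define z where "z = (\<lambda>S x y. override_on y (\<lambda>i. x i + y i) S :: 'i \<Rightarrow> 'a)"
  define u where "u = (\<lambda>x. of_bool (atom K x = q) * sg (T x))"
  define X where "X = (\<lambda>x y. \<Sum>S\<in>Pow V. F (z S x y))"
  define A where "A = avg ?\<Omega> (\<lambda>x. avg ?\<Omega> (\<lambda>y. u x * sg (X x y)))"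
  have fin: "finite ?\<Omega>" "?\<Omega> \<noteq> {}" using finite_PiE_E V PiE_E_nonempty by blast+
  have fc: "finite ?c" using V K by (rule finite_mixed_terms)
  have z\<Omega>: "z S x y \<in> ?\<Omega>" if "x \<in> ?\<Omega>" "y \<in> ?\<Omega>" "S \<subseteq> V" for S x y
    using bij_betwE[OF bij_corner[OF V that(1,3)]] that(2) by (simp add: z_def)
  \<comment> \<open>Union bound over the corners; the factor 2 is the drop of a sign from 1 to
    -1.\<close>
  have lower: "1 - 2 * 2 ^ card V * \<epsilon> \<le> avg ?\<Omega> (\<lambda>y. sg (T x) * sg (X x y))" if x: "x \<in> ?\<Omega>" for x
  proof -
    have pt: "1 - 2 * (\<Sum>S\<in>Pow V. of_bool (F (z S x y) \<noteq> T (z S x y))) \<le> sg (T x) * sg (X x y)" for y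
    proof (cases "\<forall>S\<in>Pow V. F (z S x y) = T (z S x y)")
      case True
      then have "X x y = (\<Sum>S\<in>Pow V. T (z S x y))" by (simp add: X_def)
      also have "\<dots> = T (override_on y x V)"
        unfolding z_def using V by (intro mform_corner_sum[OF T]) auto
      also have "\<dots> = T x" by (rule mform_cong[OF T]) simp
      finally show ?thesis using True by simp
    next
      case False
      then obtain S where S: "S \<in> Pow V" "F (z S x y) \<noteq> T (z S x y)" by blast
      have "(1::real) = of_bool (F (z S x y) \<noteq> T (z S x y))" using S by simp
      also have "\<dots> \<le> (\<Sum>S\<in>Pow V. of_bool (F (z S x y) \<noteq> T (z S x y)))"
        using S(1) V by (intro member_le_sum[where f = "\<lambda>S. of_bool (F (z S x y) \<noteq> T (z S x y))"]) auto
      finally have "1 - 2 * (\<Sum>S\<in>Pow V. of_bool (F (z S x y) \<noteq> T (z S x y))) \<le> (- 1 :: real)" by simp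
      also have "- 1 \<le> sg (T x) * sg (X x y)" by (simp add: sg_def)
      finally show ?thesis .
    qed
    have "avg ?\<Omega> (\<lambda>y. of_bool (F (z S x y) \<noteq> T (z S x y))) \<le> \<epsilon>" if "S \<in> Pow V" for S
      using avg_bij[OF bij_corner[OF V x], of S "\<lambda>w. of_bool (F w \<noteq> T w)"] that err by (simp add: z_def)
    then have "(\<Sum>S\<in>Pow V. avg ?\<Omega> (\<lambda>y. of_bool (F (z S x y) \<noteq> T (z S x y)))) \<le> (\<Sum>S\<in>Pow V. \<epsilon>)"
      by (rule sum_mono)
    then have "1 - 2 * 2 ^ card V * \<epsilon> \<le> avg ?\<Omega> (\<lambda>y. 1 - 2 * (\<Sum>S\<in>Pow V. of_bool (F (z S x y) \<noteq> T (z S x y))))"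
      unfolding avg_diff avg_cmult avg_sum avg_const[OF fin] using V by (simp add: card_Pow)
    also have "\<dots> \<le> avg ?\<Omega> (\<lambda>y. sg (T x) * sg (X x y))" by (intro avg_mono pt)
    finally show ?thesis .
  qed
  have "avg ?\<Omega> (\<lambda>x. of_bool (atom K x = q)) * (1 - 2 * 2 ^ card V * \<epsilon>)
      = avg ?\<Omega> (\<lambda>x. of_bool (atom K x = q) * (1 - 2 * 2 ^ card V * \<epsilon>))" by (simp only: avg_multc)
  also have "\<dots> \<le> avg ?\<Omega> (\<lambda>x. of_bool (atom K x = q) * avg ?\<Omega> (\<lambda>y. sg (T x) * sg (X x y)))"
    using lower by (intro avg_mono mult_left_mono) auto
  also have "\<dots> = A" unfolding A_def u_def by (simp only: avg_cmult[symmetric] mult.assoc)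
  finally have 1: "avg ?\<Omega> (\<lambda>x. of_bool (atom K x = q)) * (1 - 2 * 2 ^ card V * \<epsilon>) \<le> A" .
  \<comment> \<open>On the atom q the corner sum X depends only on the mixed pattern r. So A is a
    sum over r with signs \<open>s r\<close>, whose terms are all close to the same share of the
    average of u; the triangle inequality makes the unknown signs harmless. For patterns that never
    occur the sign is set to 1.\<close>
  have "\<exists>s. \<bar>s\<bar> = 1 \<and> (\<forall>x\<in>?\<Omega>. \<forall>y\<in>?\<Omega>. atom K x = q \<and> mixed_pattern ?c x y = r \<longrightarrow> sg (X x y) = s)" for r
  proof (cases "\<exists>x\<in>?\<Omega>. \<exists>y\<in>?\<Omega>. atom K x = q \<and> mixed_pattern ?c x y = r")
    case True
    then obtain x0 y0 where 0: "x0 \<in> ?\<Omega>" "y0 \<in> ?\<Omega>" "atom K x0 = q" "mixed_pattern ?c x0 y0 = r" by blast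
    have "X x y = X x0 y0" if "x \<in> ?\<Omega>" "y \<in> ?\<Omega>" "atom K x = q" "mixed_pattern ?c x y = r" for x y
      unfolding X_def
    proof (rule sum.cong[OF refl])
      fix S assume "S \<in> Pow V"
      then show "F (z S x y) = F (z S x0 y0)"
        using that 0 by (intro F z\<Omega>) (auto simp: z_def intro!: atom_corner_determined[OF V K])
    qed
    then show ?thesis by (intro exI[of _ "sg (X x0 y0)"]) auto
  next
    case False
    then show ?thesis by (intro exI[of _ 1]) auto
  qed
  then obtain s where s: "\<And>r. \<bar>s r\<bar> = 1"
    "\<And>r x y. x \<in> ?\<Omega> \<Longrightarrow> y \<in> ?\<Omega> \<Longrightarrow> atom K x = q \<Longrightarrow> mixed_pattern ?c x y = r \<Longrightarrow> sg (X x y) = s r"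
    by metis
  define Q where "Q = (\<lambda>r. avg ?\<Omega> (\<lambda>x. avg ?\<Omega> (\<lambda>y. u x * of_bool (mixed_pattern ?c x y = r))))"
  have "A = avg ?\<Omega> (\<lambda>x. avg ?\<Omega> (\<lambda>y. \<Sum>r\<in>Pow ?c. s r * (u x * of_bool (mixed_pattern ?c x y = r))))"
    unfolding A_def
  proof (intro avg_cong)
    fix x y assume xy: "x \<in> ?\<Omega>" "y \<in> ?\<Omega>"
    let ?r = "mixed_pattern ?c x y"
    have "(\<Sum>r\<in>Pow ?c. s r * (u x * of_bool (?r = r))) = (\<Sum>r\<in>Pow ?c. if r = ?r then s ?r * u x else 0)"
      by (intro sum.cong refl) auto
    also have "\<dots> = s ?r * u x" using fc by (simp add: mixed_pattern_subset)
    also have "\<dots> = u x * sg (X x y)"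
      using s(2)[OF xy _ refl] by (cases "atom K x = q") (auto simp: u_def)
    finally show "u x * sg (X x y) = (\<Sum>r\<in>Pow ?c. s r * (u x * of_bool (?r = r)))" ..
  qed
  also have "\<dots> = (\<Sum>r\<in>Pow ?c. s r * Q r)" by (simp only: avg_sum avg_cmult Q_def)
  also have "\<dots> \<le> \<bar>\<Sum>r\<in>Pow ?c. s r * Q r\<bar>" by simp
  also have "\<dots> \<le> (\<Sum>r\<in>Pow ?c. \<bar>s r * Q r\<bar>)" by (rule sum_abs)
  also have "\<dots> \<le> (\<Sum>r\<in>Pow ?c. (1 / 2) ^ card ?c * \<bar>avg ?\<Omega> u\<bar> + \<theta>)"
  proof (rule sum_mono)
    fix r assume "r \<in> Pow ?c"
    have "\<bar>u x\<bar> \<le> 1" for x by (simp add: u_def abs_mult)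
    then have "\<bar>Q r - (1 / 2) ^ card ?c * avg ?\<Omega> u\<bar> \<le> \<theta>" unfolding Q_def
      using \<open>r \<in> Pow ?c\<close> by (intro pattern_independent[OF V K reg \<theta>]) auto
    moreover have "\<bar>(1 / 2) ^ card ?c * avg ?\<Omega> u\<bar> = (1 / 2) ^ card ?c * \<bar>avg ?\<Omega> u\<bar>" by (simp add: abs_mult)
    ultimately have "\<bar>Q r\<bar> \<le> (1 / 2) ^ card ?c * \<bar>avg ?\<Omega> u\<bar> + \<theta>" by linarith
    then show "\<bar>s r * Q r\<bar> \<le> (1 / 2) ^ card ?c * \<bar>avg ?\<Omega> u\<bar> + \<theta>"
      by (simp add: abs_mult s)
  qed
  also have "\<dots> = \<bar>avg ?\<Omega> u\<bar> + 2 ^ card ?c * \<theta>"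
    using fc by (simp add: card_Pow distrib_left power_divide)
  finally show ?thesis using 1 unfolding u_def by linarith
qed

section \<open>Majority votes on atoms\<close>

definition majority :: "'i set \<Rightarrow> (('i \<Rightarrow> 'a) \<Rightarrow> bit) \<Rightarrow> ('i, 'a) typed_form set \<Rightarrow> ('i, 'a) typed_form set \<Rightarrow> bit" where
  "majority V T K q = (if 0 \<le> avg (PiE V E) (\<lambda>x. of_bool (atom K x = q) * sg (T x)) then 0 else 1)"

text \<open>On an atom of mass p and signed mass a, the minority value occupies
  \<open>(p - \<bar>a\<bar>) / 2\<close>, and \<open>atom_correlation\<close> bounds
  \<open>\<bar>a\<bar>\<close> from below.\<close>

lemma majority_error:
  assumes V: "finite V" and K: "form_family V K" and reg: "regular (\<theta> ^ (2 ^ card V)) K"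
    and \<theta>: "0 \<le> \<theta>" "\<theta> \<le> 1" and T: "mform V T"
    and F: "\<And>x y. x \<in> PiE V E \<Longrightarrow> y \<in> PiE V E \<Longrightarrow> atom K x = atom K y \<Longrightarrow> F x = F y"
    and err: "avg (PiE V E) (\<lambda>x. of_bool (F x \<noteq> T x)) \<le> \<epsilon>"
  shows "avg (PiE V E) (\<lambda>x. of_bool (atom K x = q \<and> T x \<noteq> majority V T K q))
    \<le> 2 ^ card V * \<epsilon> * avg (PiE V E) (\<lambda>x. of_bool (atom K x = q)) + 2 ^ card (mixed_terms K) * \<theta> / 2"
proof -
  let ?a = "avg (PiE V E) (\<lambda>x. of_bool (atom K x = q) * sg (T x))"
  let ?p = "avg (PiE V E) (\<lambda>x. of_bool (atom K x = q))"
  have "avg (PiE V E) (\<lambda>x. of_bool (atom K x = q \<and> T x \<noteq> majority V T K q))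
    = avg (PiE V E) (\<lambda>x. (of_bool (atom K x = q) - sg (majority V T K q) * (of_bool (atom K x = q) * sg (T x))) * (1 / 2))"
    by (intro avg_cong) (auto simp: sg_def)
  also have "\<dots> = (?p - sg (majority V T K q) * ?a) * (1 / 2)"
    unfolding avg_multc avg_diff avg_cmult ..
  also have "sg (majority V T K q) * ?a = \<bar>?a\<bar>"
    unfolding majority_def by (cases "0 \<le> ?a") simp_all
  finally have *: "avg (PiE V E) (\<lambda>x. of_bool (atom K x = q \<and> T x \<noteq> majority V T K q)) = (?p - \<bar>?a\<bar>) * (1 / 2)" .
  have "?p * (1 - 2 * 2 ^ card V * \<epsilon>) \<le> \<bar>?a\<bar> + 2 ^ card (mixed_terms K) * \<theta>"
    by (rule atom_correlation[OF V K reg \<theta> T F err])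
  moreover have "?p * (1 - 2 * 2 ^ card V * \<epsilon>) = ?p - 2 * (2 ^ card V * \<epsilon> * ?p)"
    by (simp only: right_diff_distrib mult_1_right mult_ac)
  ultimately have "?p - 2 * (2 ^ card V * \<epsilon> * ?p) \<le> \<bar>?a\<bar> + 2 ^ card (mixed_terms K) * \<theta>" by simp
  moreover have "p - 2 * e \<le> a + c \<Longrightarrow> (p - a) * (1 / 2) \<le> e + c / 2" for p e a c :: real by simp
  ultimately show ?thesis unfolding * by blast
qed

text \<open>The mixed value of \<open>(p, {})\<close> is p at y, so the pattern of these terms is
  the atom of y; take the constant weight 1.\<close>

lemma atom_mass:
  assumes V: "finite V" and K: "form_family V K" and reg: "regular (\<theta> ^ (2 ^ card V)) K"
    and \<theta>: "0 \<le> \<theta>" "\<theta> \<le> 1" and q: "q \<subseteq> K"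
  shows "\<bar>avg (PiE V E) (\<lambda>x. of_bool (atom K x = q)) - (1 / 2) ^ card K\<bar> \<le> \<theta>"
proof -
  let ?\<Omega> = "PiE V E" and ?c = "(\<lambda>p. (p, {} :: 'i set)) ` K"
  have fin: "finite ?\<Omega>" "?\<Omega> \<noteq> {}" using finite_PiE_E V PiE_E_nonempty by blast+
  have inj: "inj_on (\<lambda>p. (p, {} :: 'i set)) K" by (simp add: inj_on_def)
  have sub: "?c \<subseteq> mixed_terms K" using K by (auto simp: mixed_terms_def form_family_def)
  have "mixed_pattern ?c x y = (\<lambda>p. (p, {} :: 'i set)) ` atom K y" for x y
    by (auto simp: mixed_pattern_def mixed_value_def atom_def)
  then have "mixed_pattern ?c x y = (\<lambda>p. (p, {} :: 'i set)) ` q \<longleftrightarrow> atom K y = q" for x y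
    using inj_on_image_eq_iff[OF inj atom_subset q] by simp
  then have "avg ?\<Omega> (\<lambda>x. avg ?\<Omega> (\<lambda>y. 1 * of_bool (mixed_pattern ?c x y = (\<lambda>p. (p, {} :: 'i set)) ` q)))
      = avg ?\<Omega> (\<lambda>x. of_bool (atom K x = q))"
    by (simp add: avg_const[OF fin])
  moreover have "\<bar>avg ?\<Omega> (\<lambda>x. avg ?\<Omega> (\<lambda>y. 1 * of_bool (mixed_pattern ?c x y = (\<lambda>p. (p, {} :: 'i set)) ` q)))
      - (1 / 2) ^ card ?c * avg ?\<Omega> (\<lambda>_. 1)\<bar> \<le> \<theta>"
  proof (rule pattern_independent[OF V K reg \<theta> _ sub])
    show "(\<lambda>p. (p, {} :: 'i set)) ` q \<subseteq> ?c" using q by blast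
  qed simp
  ultimately show ?thesis by (simp add: avg_const[OF fin] card_image[OF inj])
qed

end

section \<open>From exact representations to partition rank\<close>

text \<open>Additivity in variable i, transported to value patterns: q1, q2, q3 are related as the
  atoms of \<open>x(i := a)\<close>, \<open>x(i := b)\<close> and \<open>x(i := a + b)\<close> are.
  Members involving i add up, all others agree.\<close>

definition block_additive ::
    "'i set \<Rightarrow> ('i, 'a) typed_form set \<Rightarrow> (('i, 'a) typed_form set \<Rightarrow> bit) \<Rightarrow> bool" where
  "block_additive V K G \<longleftrightarrow> (\<forall>i\<in>V. \<forall>q1 q2 q3. q1 \<subseteq> K \<longrightarrow> q2 \<subseteq> K \<longrightarrow> q3 \<subseteq> K \<longrightarrow>
     (\<forall>p\<in>K. if i \<in> fst p then p \<in> q3 \<longleftrightarrow> (p \<in> q1) \<noteq> (p \<in> q2)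
        else (p \<in> q1 \<longleftrightarrow> p \<in> q3) \<and> (p \<in> q2 \<longleftrightarrow> p \<in> q3)) \<longrightarrow>
     G q3 = G q1 + G q2)"

lemma mform_plus:
  assumes "mform I f" "mform I g"
  shows "mform I (\<lambda>x. f x + g x)"
  using mform_sum[of "UNIV :: bool set" I "\<lambda>b. if b then f else g"] assms
  by (simp add: UNIV_bool add.commute)

text \<open>The pattern map is left general because it is needed both for \<open>atom K\<close> and
  for patterns in which one form is forced to be present and all forms sharing a variable with it
  are dropped.\<close>

lemma block_additive_mform:
  fixes K :: "('i, 'a::ab_group_add) typed_form set" and A :: "('i \<Rightarrow> 'a) \<Rightarrow> ('i, 'a) typed_form set"
  assumes K: "form_family V K" and G: "block_additive V K G"
    and A: "\<And>x. A x \<subseteq> K" "\<And>x y. (\<And>i. i \<in> I \<Longrightarrow> x i = y i) \<Longrightarrow> A x = A y" and I: "I \<subseteq> V"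
    and mem: "\<And>i p x a b. i \<in> I \<Longrightarrow> p \<in> K \<Longrightarrow>
      if i \<in> fst p then p \<in> A (x(i := a + b)) \<longleftrightarrow> (p \<in> A (x(i := a))) \<noteq> (p \<in> A (x(i := b)))
      else (p \<in> A (x(i := a)) \<longleftrightarrow> p \<in> A (x(i := a + b))) \<and> (p \<in> A (x(i := b)) \<longleftrightarrow> p \<in> A (x(i := a + b)))"
  shows "mform I (\<lambda>x. G (A x))"
  unfolding mform_def
proof (intro conjI allI impI ballI)
  fix x y :: "'i \<Rightarrow> 'a" assume "\<forall>i\<in>I. x i = y i"
  then show "G (A x) = G (A y)" using A(2)[of x y] by simp
next
  fix i and x :: "'i \<Rightarrow> 'a" and a b assume i: "i \<in> I"
  then show "G (A (x(i := a + b))) = G (A (x(i := a))) + G (A (x(i := b)))"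
    using G[unfolded block_additive_def, rule_format, of i "A (x(i := a))" "A (x(i := b))" "A (x(i := a + b))"]
      mem[OF i] A(1) I by blast
qed

lemma atom_additive:
  assumes "form_family V K" "p \<in> K"
  shows "if i \<in> fst p then p \<in> atom K (x(i := a + b)) \<longleftrightarrow> (p \<in> atom K (x(i := a))) \<noteq> (p \<in> atom K (x(i := b)))
      else (p \<in> atom K (x(i := a)) \<longleftrightarrow> p \<in> atom K (x(i := a + b))) \<and> (p \<in> atom K (x(i := b)) \<longleftrightarrow> p \<in> atom K (x(i := a + b)))"
proof -
  have m: "mform (fst p) (snd p)" using assms by (auto simp: form_family_def)
  show ?thesis
  proof (cases "i \<in> fst p")
    case True
    have "snd p (x(i := a + b)) = snd p (x(i := a)) + snd p (x(i := b))" by (rule mform_add[OF m True])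
    then show ?thesis using True assms(2)
      by (cases "snd p (x(i := a))"; cases "snd p (x(i := b))") (simp_all add: atom_def)
  next
    case False
    then have "snd p (x(i := e)) = snd p x" for e by (intro mform_cong[OF m]) auto
    then show ?thesis using False by (simp add: atom_def)
  qed
qed

lemma atom_cong:
  assumes "form_family V K" "\<And>i. i \<in> V \<Longrightarrow> x i = y i"
  shows "atom K x = atom K y"
proof -
  have "snd p x = snd p y" if "p \<in> K" for p
    using that assms by (intro mform_cong[of "fst p" "snd p"]) (auto simp: form_family_def)
  then show ?thesis unfolding atom_def by (intro Collect_cong conj_cong refl) simp
qed

lemma mform_atom:
  assumes K: "form_family V K" and G: "block_additive V K G"
  shows "mform V (\<lambda>x. G (atom K x))"
  by (rule block_additive_mform[OF K G atom_subset _ subset_refl atom_additive[OF K]])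
    (rule atom_cong[OF K])

context coord_groups
begin

lemma avg_swap_coordinate:
  assumes "finite V" "i \<in> V"
  shows "avg (PiE V E) (\<lambda>x. avg (PiE V E) (\<lambda>y. g (x(i := y i)) (y(i := x i)))) = avg (PiE V E) (\<lambda>x. avg (PiE V E) (g x))"
proof -
  let ?\<Omega> = "PiE V E"
  let ?h = "\<lambda>(x, y). (x(i := y i), y(i := x i))"
  have "(\<Sum>(x, y)\<in>?\<Omega> \<times> ?\<Omega>. g (x(i := y i)) (y(i := x i))) = (\<Sum>(x, y)\<in>?\<Omega> \<times> ?\<Omega>. g x y)"
    by (rule sum.reindex_bij_witness[where i = ?h and j = ?h])
      (use assms in \<open>auto simp: PiE_def Pi_def extensional_def\<close>)
  then show ?thesis by (simp add: avg_def sum.cartesian_product sum_divide_distrib[symmetric])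
qed

text \<open>T is additive along x, \<open>x(i := y i)\<close>, \<open>x(i := y i + x i)\<close>. So
  it is enough to find one such triple lying in the atoms q1, q2, q3 at which T takes the majority
  value three times. Triples lying in these atoms have a definite mass, and
  \<open>majority_error\<close>, applied to each point after a measure-preserving change of
  variables, shows that too few of them are bad.\<close>

lemma majority_block_additive:
  assumes V: "finite V" and K: "form_family V K" and reg: "regular (\<theta> ^ (2 ^ card V)) K"
    and \<theta>: "0 \<le> \<theta>" "\<theta> \<le> 1" and T: "mform V T"
    and F: "\<And>x y. x \<in> PiE V E \<Longrightarrow> y \<in> PiE V E \<Longrightarrow> atom K x = atom K y \<Longrightarrow> F x = F y"
    and err: "avg (PiE V E) (\<lambda>x. of_bool (F x \<noteq> T x)) \<le> \<epsilon>"
    and small: "2 ^ card V * \<epsilon> \<le> 1 / 16" "\<theta> * 2 ^ (card (mixed_terms K) + card K) \<le> 1 / 16"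
  shows "block_additive V K (majority V T K)"
  unfolding block_additive_def
proof (intro ballI allI impI)
  fix i q1 q2 q3
  assume i: "i \<in> V" and q: "q1 \<subseteq> K" "q2 \<subseteq> K" "q3 \<subseteq> K"
    and rel: "\<forall>p\<in>K. if i \<in> fst p then p \<in> q3 \<longleftrightarrow> (p \<in> q1) \<noteq> (p \<in> q2)
        else (p \<in> q1 \<longleftrightarrow> p \<in> q3) \<and> (p \<in> q2 \<longleftrightarrow> p \<in> q3)"
  let ?\<Omega> = "PiE V E" and ?G = "majority V T K"
  define B where "B = {p \<in> K. i \<in> fst p}"
  \<comment> \<open>The mixed value of \<open>j p\<close> is p at \<open>x(i := y i)\<close>. Hence
    the pattern of c gives the values there of all members involving i, while the other members keep
    their values at x.\<close>
  define j where "j = (\<lambda>p :: ('i, 'a) typed_form. (p, fst p - {i}))"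
  define c where "c = j ` B"
  have fin: "finite ?\<Omega>" "?\<Omega> \<noteq> {}" using finite_PiE_E V PiE_E_nonempty by blast+
  have inj: "inj_on j B" by (auto simp: inj_on_def j_def)
  have c: "c \<subseteq> mixed_terms K" by (auto simp: c_def j_def B_def mixed_terms_def)
  have form: "mform (fst p) (snd p)" if "p \<in> K" for p using K that by (auto simp: form_family_def)
  have pat: "mixed_pattern c x y = j ` s \<longleftrightarrow> {p \<in> B. snd p (x(i := y i)) = 1} = s" if s: "s \<subseteq> B" for x y s
  proof -
    have "mixed_value (j p) x y = snd p (x(i := y i))" if "p \<in> B" for p
      unfolding j_def mixed_value_def fst_conv snd_conv
      by (rule mform_cong[OF form]) (use that in \<open>auto simp: B_def override_on_def\<close>)
    then have "mixed_pattern c x y = j ` {p \<in> B. snd p (x(i := y i)) = 1}"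
      by (auto simp: mixed_pattern_def c_def)
    then show ?thesis using inj_on_image_eq_iff[OF inj _ s, of "{p \<in> B. snd p (x(i := y i)) = 1}"] by simp
  qed
  define r where "r = (\<lambda>q. j ` (q \<inter> B))"
  have r: "r q \<subseteq> c" for q by (auto simp: r_def c_def)
  define m where "m = (\<lambda>q. avg ?\<Omega> (\<lambda>x. of_bool (atom K x = q \<and> T x \<noteq> ?G q)))"
  define P where "P = (\<lambda>q. avg ?\<Omega> (\<lambda>x. of_bool (atom K x = q)))"
  define g where "g = (\<lambda>q r x y. of_bool (atom K x = q \<and> T x \<noteq> ?G q) * of_bool (mixed_pattern c x y = r) :: real)"
  define W where "W = (\<lambda>x y. atom K x = q1 \<and> mixed_pattern c x y = r q2)"
  define k' where "k' = card c"
  let ?k = "card (mixed_terms K)"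
  \<comment> \<open>Besides its atom, each of the three points retains a pattern event on c. The
    failure masses thus carry the same factor \<open>(1 / 2) ^ k'\<close> as the mass of W and can
    be compared with it.\<close>
  have W2: "atom K (x(i := y i)) = q2" and W3: "atom K (x(i := y i + x i)) = q3"
    and W4: "mixed_pattern c (x(i := y i)) (y(i := x i)) = r q1"
    and W5: "mixed_pattern c (x(i := y i + x i)) y = r q2" if "W x y" for x y
  proof -
    have a: "atom K x = q1" and "{p \<in> B. snd p (x(i := y i)) = 1} = q2 \<inter> B"
      using that pat[of "q2 \<inter> B"] by (auto simp: W_def r_def)
    then have b: "p \<in> atom K (x(i := y i)) \<longleftrightarrow> p \<in> q2" if "p \<in> B" for p
      using that by (auto simp: atom_def B_def)
    have add: "if i \<in> fst p then p \<in> atom K (x(i := y i + x i)) \<longleftrightarrow> (p \<in> atom K (x(i := y i))) \<noteq> (p \<in> q1)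
      else (p \<in> atom K (x(i := y i)) \<longleftrightarrow> p \<in> atom K (x(i := y i + x i))) \<and> (p \<in> q1 \<longleftrightarrow> p \<in> atom K (x(i := y i + x i)))"
      if "p \<in> K" for p
      using atom_additive[OF K that, of i x "y i" "x i"] unfolding fun_upd_triv a .
    have "p \<in> atom K (x(i := y i)) \<longleftrightarrow> p \<in> q2" and "p \<in> atom K (x(i := y i + x i)) \<longleftrightarrow> p \<in> q3" if "p \<in> K" for p
    proof -
      have 1: "p \<in> atom K (x(i := y i)) \<longleftrightarrow> p \<in> q2"
      proof (cases "i \<in> fst p")
        case True
        then show ?thesis using b that by (simp add: B_def)
      next
        case False
        then show ?thesis using add[OF that] rel[rule_format, OF that] by simp
      qed
      then show "p \<in> atom K (x(i := y i)) \<longleftrightarrow> p \<in> q2" .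
      show "p \<in> atom K (x(i := y i + x i)) \<longleftrightarrow> p \<in> q3"
        using add[OF that] rel[rule_format, OF that] 1 by (cases "i \<in> fst p") auto
    qed
    then show "atom K (x(i := y i)) = q2" "atom K (x(i := y i + x i)) = q3"
      using q atom_subset by blast+
    show "mixed_pattern c (x(i := y i)) (y(i := x i)) = r q1"
      unfolding r_def pat[OF Int_lower2] using a by (auto simp: atom_def B_def)
    show "mixed_pattern c (x(i := y i + x i)) y = r q2"
      unfolding r_def pat[OF Int_lower2] using \<open>{p \<in> B. snd p (x(i := y i)) = 1} = q2 \<inter> B\<close> by simp
  qed
  have g_le: "avg ?\<Omega> (\<lambda>x. avg ?\<Omega> (\<lambda>y. g q (r s) x y)) \<le> (1 / 2) ^ k' * m q + \<theta>" for q s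
  proof -
    have "\<bar>avg ?\<Omega> (\<lambda>x. avg ?\<Omega> (\<lambda>y. g q (r s) x y)) - (1 / 2) ^ k' * m q\<bar> \<le> \<theta>"
      unfolding g_def k'_def m_def by (rule pattern_independent[OF V K reg \<theta> _ c r]) simp
    then show ?thesis by linarith
  qed
  have W_ge: "(1 / 2) ^ k' * P q1 - \<theta> \<le> avg ?\<Omega> (\<lambda>x. avg ?\<Omega> (\<lambda>y. of_bool (W x y)))"
  proof -
    have "\<bar>avg ?\<Omega> (\<lambda>x. avg ?\<Omega> (\<lambda>y. of_bool (atom K x = q1) * of_bool (mixed_pattern c x y = r q2))) - (1 / 2) ^ k' * P q1\<bar> \<le> \<theta>"
      unfolding k'_def P_def by (rule pattern_independent[OF V K reg \<theta> _ c r]) simp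
    then show ?thesis by (simp add: W_def of_bool_conj)
  qed
  have "\<exists>x\<in>?\<Omega>. \<exists>y\<in>?\<Omega>. W x y \<and> T x = ?G q1 \<and> T (x(i := y i)) = ?G q2 \<and> T (x(i := y i + x i)) = ?G q3"
  proof (rule ccontr)
    assume neg: "\<not> ?thesis"
    have "of_bool (W x y) \<le> g q1 (r q2) x y + g q2 (r q1) (x(i := y i)) (y(i := x i)) + g q3 (r q2) (x(i := y i + x i)) y"
      if "x \<in> ?\<Omega>" "y \<in> ?\<Omega>" for x y
    proof (cases "W x y")
      case True
      have "atom K x = q1" "mixed_pattern c x y = r q2" using True by (auto simp: W_def)
      moreover have "T x \<noteq> ?G q1 \<or> T (x(i := y i)) \<noteq> ?G q2 \<or> T (x(i := y i + x i)) \<noteq> ?G q3"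
        using neg that True by blast
      ultimately show ?thesis using W2[OF True] W3[OF True] W4[OF True] W5[OF True] True
        unfolding g_def by (auto simp del: bit_not_zero_iff bit_not_one_iff)
    qed (simp add: g_def)
    then have "avg ?\<Omega> (\<lambda>x. avg ?\<Omega> (\<lambda>y. of_bool (W x y))) \<le> avg ?\<Omega> (\<lambda>x. avg ?\<Omega> (\<lambda>y.
        g q1 (r q2) x y + g q2 (r q1) (x(i := y i)) (y(i := x i)) + g q3 (r q2) (x(i := y i + x i)) y))"
      by (intro avg_mono)
    also have "\<dots> = avg ?\<Omega> (\<lambda>x. avg ?\<Omega> (\<lambda>y. g q1 (r q2) x y)) + avg ?\<Omega> (\<lambda>x. avg ?\<Omega> (\<lambda>y. g q2 (r q1) x y))
        + avg ?\<Omega> (\<lambda>x. avg ?\<Omega> (\<lambda>y. g q3 (r q2) x y))"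
    proof -
      have "avg ?\<Omega> (\<lambda>x. avg ?\<Omega> (\<lambda>y. g q3 (r q2) (x(i := y i + x i)) y)) = avg ?\<Omega> (\<lambda>y. avg ?\<Omega> (\<lambda>x. g q3 (r q2) (x(i := y i + x i)) y))"
        by (rule avg_swap)
      also have "\<dots> = avg ?\<Omega> (\<lambda>y. avg ?\<Omega> (\<lambda>x. g q3 (r q2) x y))"
      proof (rule avg_cong)
        fix y assume y: "y \<in> ?\<Omega>"
        have "override_on x (\<lambda>l. y l + x l) {i} = x(i := y i + x i)" for x :: "'i \<Rightarrow> 'a"
          by (auto simp: override_on_def)
        then show "avg ?\<Omega> (\<lambda>x. g q3 (r q2) (x(i := y i + x i)) y) = avg ?\<Omega> (\<lambda>x. g q3 (r q2) x y)"
          using avg_bij[OF bij_corner[OF V y, of "{i}"], of "\<lambda>x. g q3 (r q2) x y"] i by simp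
      qed
      also have "\<dots> = avg ?\<Omega> (\<lambda>x. avg ?\<Omega> (\<lambda>y. g q3 (r q2) x y))" by (rule avg_swap)
      finally show ?thesis unfolding avg_add using avg_swap_coordinate[OF V i, of "g q2 (r q1)"] by simp
    qed
    also have "\<dots> \<le> ((1 / 2) ^ k' * m q1 + \<theta>) + ((1 / 2) ^ k' * m q2 + \<theta>) + ((1 / 2) ^ k' * m q3 + \<theta>)"
      by (intro add_mono g_le)
    finally have 1: "(1 / 2) ^ k' * P q1 - \<theta> \<le> (1 / 2) ^ k' * (m q1 + m q2 + m q3) + 3 * \<theta>"
      using W_ge by (simp add: algebra_simps)
    \<comment> \<open>M is the ideal mass of an atom and \<kappa> collects the \<theta>-errors, with
      16 \<kappa> \<le> M. After scaling by \<open>2 ^ k'\<close>, three failure masses of about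
      M/16 + \<kappa>/2 would have to cover a mass of about M.\<close>
    define M where "M = (1 / 2 :: real) ^ card K"
    define \<kappa> where "\<kappa> = 2 ^ ?k * \<theta>"
    have m_le: "m q \<le> 1 / 16 * P q + \<kappa> / 2" for q
    proof -
      have "m q \<le> 2 ^ card V * \<epsilon> * P q + \<kappa> / 2"
        unfolding m_def P_def \<kappa>_def by (rule majority_error[OF V K reg \<theta> T F err])
      moreover have "2 ^ card V * \<epsilon> * P q \<le> 1 / 16 * P q"
        using small(1) by (intro mult_right_mono) (simp_all add: P_def avg_nonneg)
      ultimately show ?thesis by linarith
    qed
    have P: "\<bar>P q - M\<bar> \<le> \<theta>" if "q \<subseteq> K" for q
      unfolding P_def M_def by (rule atom_mass[OF V K reg \<theta> that])
    have "2 ^ k' * ((1 / 2) ^ k' * P q1 - \<theta>) \<le> 2 ^ k' * ((1 / 2) ^ k' * (m q1 + m q2 + m q3) + 3 * \<theta>)"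
      using 1 by (intro mult_left_mono) auto
    then have "P q1 - 2 ^ k' * \<theta> \<le> m q1 + m q2 + m q3 + 3 * (2 ^ k' * \<theta>)"
      by (simp add: right_diff_distrib distrib_left mult.assoc[symmetric] power_mult_distrib[symmetric])
    moreover have "2 ^ k' * \<theta> \<le> \<kappa>"
      using card_mono[OF finite_mixed_terms[OF V K] c] \<theta>(1) unfolding \<kappa>_def k'_def
      by (intro mult_right_mono power_increasing) auto
    moreover have "\<theta> \<le> \<kappa>" using \<theta>(1) unfolding \<kappa>_def by (simp add: mult_le_cancel_right1)
    moreover have "16 * \<kappa> \<le> M"
      using small(2) unfolding \<kappa>_def M_def by (simp add: power_add field_simps power_divide)
    moreover have "M > 0" by (simp add: M_def)
    ultimately show False
      using P[OF q(1)] P[OF q(2)] P[OF q(3)] m_le[of q1] m_le[of q2] m_le[of q3] by linarith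
  qed
  then obtain x y where "T x = ?G q1" "T (x(i := y i)) = ?G q2" "T (x(i := y i + x i)) = ?G q3" by blast
  moreover have "T (x(i := y i + x i)) = T (x(i := y i)) + T (x(i := x i))" by (rule mform_add[OF T i])
  ultimately show "?G q3 = ?G q1 + ?G q2" by (simp add: add.commute)
qed

text \<open>The sum of T and the majority function is multilinear by block additivity. Adding
  \<open>majority_error\<close> over all atoms, it equals 1 on a share below
  \<open>(1 / 2) ^ card V\<close>, so \<open>mform_few_ones\<close> makes it vanish; this is the
  origin of that factor in the smallness conditions.\<close>

lemma majority_exact:
  assumes V: "finite V" and K: "form_family V K" and reg: "regular (\<theta> ^ (2 ^ card V)) K"
    and \<theta>: "0 \<le> \<theta>" "\<theta> \<le> 1" and T: "mform V T"
    and F: "\<And>x y. x \<in> PiE V E \<Longrightarrow> y \<in> PiE V E \<Longrightarrow> atom K x = atom K y \<Longrightarrow> F x = F y"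
    and err: "avg (PiE V E) (\<lambda>x. of_bool (F x \<noteq> T x)) \<le> \<epsilon>"
    and small: "2 ^ card V * \<epsilon> \<le> (1 / 2) ^ card V / 16" "\<theta> * 2 ^ (card (mixed_terms K) + card K) \<le> (1 / 2) ^ card V / 16"
  shows "block_additive V K (majority V T K)" and "\<And>x. x \<in> PiE V E \<Longrightarrow> T x = majority V T K (atom K x)"
proof -
  let ?\<Omega> = "PiE V E" and ?G = "majority V T K"
  have fin: "finite ?\<Omega>" "?\<Omega> \<noteq> {}" using finite_PiE_E V PiE_E_nonempty by blast+
  have fK: "finite K" using K by (simp add: form_family_def)
  have "(1 / 2 :: real) ^ card V \<le> 1" by (simp add: power_le_one)
  then show ba: "block_additive V K ?G"
    using small by (intro majority_block_additive[OF V K reg \<theta> T F err]) auto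
  have partition: "(\<Sum>q\<in>Pow K. of_bool (atom K x = q \<and> R q)) = (of_bool (R (atom K x)) :: real)" for R x
  proof -
    have "(\<Sum>q\<in>Pow K. of_bool (atom K x = q \<and> R q)) = (\<Sum>q\<in>Pow K. if q = atom K x then of_bool (R (atom K x)) else (0 :: real))"
      by (rule sum.cong[OF refl]) auto
    also have "\<dots> = of_bool (R (atom K x))" using fK by (simp add: atom_subset)
    finally show ?thesis .
  qed
  have "avg ?\<Omega> (\<lambda>x. of_bool (T x + ?G (atom K x) = 1)) = avg ?\<Omega> (\<lambda>x. \<Sum>q\<in>Pow K. of_bool (atom K x = q \<and> T x \<noteq> ?G q))"
  proof (rule avg_cong)
    fix x
    have "(T x + ?G (atom K x) = 1) = (T x \<noteq> ?G (atom K x))"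
      by (cases "T x"; cases "?G (atom K x)") simp_all
    then show "of_bool (T x + ?G (atom K x) = 1) = (\<Sum>q\<in>Pow K. of_bool (atom K x = q \<and> T x \<noteq> ?G q) :: real)"
      using partition[of x "\<lambda>q. T x \<noteq> ?G q"] by simp
  qed
  also have "\<dots> = (\<Sum>q\<in>Pow K. avg ?\<Omega> (\<lambda>x. of_bool (atom K x = q \<and> T x \<noteq> ?G q)))" by (rule avg_sum)
  also have "\<dots> \<le> (\<Sum>q\<in>Pow K. 2 ^ card V * \<epsilon> * avg ?\<Omega> (\<lambda>x. of_bool (atom K x = q)) + 2 ^ card (mixed_terms K) * \<theta> / 2)"
    by (intro sum_mono majority_error[OF V K reg \<theta> T F err])
  also have "\<dots> = 2 ^ card V * \<epsilon> * (\<Sum>q\<in>Pow K. avg ?\<Omega> (\<lambda>x. of_bool (atom K x = q))) + 2 ^ card K * (2 ^ card (mixed_terms K) * \<theta> / 2)"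
    using fK by (simp add: sum.distrib sum_distrib_left card_Pow)
  also have "(\<Sum>q\<in>Pow K. avg ?\<Omega> (\<lambda>x. of_bool (atom K x = q))) = 1"
    unfolding avg_sum[symmetric] using partition[of _ "\<lambda>_. True"] by (simp add: avg_const[OF fin] del: sum_of_bool_eq)
  also have "2 ^ card V * \<epsilon> * 1 + 2 ^ card K * (2 ^ card (mixed_terms K) * \<theta> / 2) < (1 / 2) ^ card V"
  proof -
    have "2 ^ card K * (2 ^ card (mixed_terms K) * \<theta> / 2) = (\<theta> * 2 ^ (card (mixed_terms K) + card K)) / 2"
      by (simp add: power_add)
    moreover have "(1 / 2 :: real) ^ card V > 0" by simp
    ultimately show ?thesis using small by linarith
  qed
  finally have *: "avg ?\<Omega> (\<lambda>x. of_bool (T x + ?G (atom K x) = 1)) < (1 / 2) ^ card V" .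
  fix x assume "x \<in> ?\<Omega>"
  then have "T x + ?G (atom K x) = 0"
    by (rule mform_few_ones[OF V mform_plus[OF T mform_atom[OF K ba]] *])
  then show "T x = ?G (atom K x)" by (cases "T x"; cases "?G (atom K x)") simp_all
qed

text \<open>The identity is demanded only on \<open>PiE J E\<close>, because the majority
  representation is exact only there. A set of products is as good as a list: equal products cancel
  in pairs.\<close>

definition partition_rank_le :: "'i set \<Rightarrow> (('i \<Rightarrow> 'a) \<Rightarrow> bit) \<Rightarrow> nat \<Rightarrow> bool" where
  "partition_rank_le J T n \<longleftrightarrow> (\<exists>R. finite R \<and> card R \<le> n \<and>
     (\<forall>(I, f, g)\<in>R. I \<subset> J \<and> I \<noteq> {} \<and> mform I f \<and> mform (J - I) g) \<and>
     (\<forall>x\<in>PiE J E. T x = (\<Sum>(I, f, g)\<in>R. f x * g x)))"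

text \<open>Additivity in a fixed variable i0 splits G into contributions of the single members p
  involving i0. Additivity in the variables of p then discards all members sharing a variable with
  p, so the cofactor of p depends only on the variables outside its type.\<close>

lemma block_additive_partition_rank:
  assumes V: "finite V" "V \<noteq> {}" and K: "form_family V K" and G: "block_additive V K G"
    and T: "\<And>x. x \<in> PiE V E \<Longrightarrow> T x = G (atom K x)"
  shows "partition_rank_le V T (card K)"
proof -
  obtain i0 where i0: "i0 \<in> V" using V by blast
  define B where "B = {p \<in> K. i0 \<in> fst p}"
  have fK: "finite K" using K by (simp add: form_family_def)
  have BK: "B \<subseteq> K" and fB: "finite B" using fK by (auto simp: B_def)
  have ty: "fst p \<subset> V" "fst p \<noteq> {}" "mform (fst p) (snd p)" if "p \<in> K" for p
    using K that by (auto simp: form_family_def)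
  \<comment> \<open>Coordinate i0 does not affect such a pattern, so s may serve as all three
    patterns.\<close>
  have zero: "G s = 0" if "s \<subseteq> K - B" for s
  proof -
    have "G s = G s + G s"
      using that by (intro G[unfolded block_additive_def, rule_format, OF i0]) (auto simp: B_def)
    then show ?thesis by simp
  qed
  have split: "G (S \<union> s) = (\<Sum>p\<in>S. G (insert p s))" if "S \<subseteq> B" "s \<subseteq> K - B" for S s
    using finite_subset[OF that(1) fB] that
  proof (induction S rule: finite_induct)
    case empty then show ?case using zero by simp
  next
    case (insert p S)
    have "G (insert p S \<union> s) = G (insert p s) + G (S \<union> s)"
      using insert.prems insert.hyps BK
      by (intro G[unfolded block_additive_def, rule_format, OF i0]) (auto simp: B_def)
    then show ?case using insert by simp
  qed
  \<comment> \<open>Additivity in i separates the members involving i from p; the separated part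
    contains no member of B and contributes 0.\<close>
  have reduce: "G (insert p s) = G (insert p {p' \<in> s. fst p' \<inter> A = {}})"
    if p: "p \<in> B" and s: "s \<subseteq> K - B" and A: "finite A" "A \<subseteq> fst p" for p s A
    using A
  proof (induction A rule: finite_induct)
    case empty then show ?case by simp
  next
    case (insert i A)
    let ?s = "{p' \<in> s. fst p' \<inter> A = {}}"
    have i: "i \<in> V" using insert.prems ty(1)[of p] p BK by blast
    have "G (insert p ?s) = G (insert p {p' \<in> s. fst p' \<inter> insert i A = {}}) + G ?s"
    proof (rule G[unfolded block_additive_def, rule_format, OF i])
      show "insert p {p' \<in> s. fst p' \<inter> insert i A = {}} \<subseteq> K" "?s \<subseteq> K" "insert p ?s \<subseteq> K"
        using p s BK by auto
      fix p' assume "p' \<in> K"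
      have "p \<notin> s" "i \<in> fst p" using p s insert.prems by auto
      then show "if i \<in> fst p' then p' \<in> insert p ?s \<longleftrightarrow> (p' \<in> insert p {p' \<in> s. fst p' \<inter> insert i A = {}}) \<noteq> (p' \<in> ?s)
        else (p' \<in> insert p {p' \<in> s. fst p' \<inter> insert i A = {}} \<longleftrightarrow> p' \<in> insert p ?s) \<and> (p' \<in> ?s \<longleftrightarrow> p' \<in> insert p ?s)"
        by auto
    qed
    moreover have "G ?s = 0" using s by (intro zero) auto
    ultimately show ?case using insert by simp
  qed
  define g where "g = (\<lambda>p x. G (insert p {p' \<in> atom K x. fst p' \<inter> fst p = {}}))"
  have form_g: "mform (V - fst p) (g p)" if p: "p \<in> B" for p
    unfolding g_def
  proof (rule block_additive_mform[OF K G])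
    show "insert p {p' \<in> atom K x. fst p' \<inter> fst p = {}} \<subseteq> K" for x
      using p BK atom_subset by fastforce
    fix x y :: "'i \<Rightarrow> 'a" assume eq: "\<And>i. i \<in> V - fst p \<Longrightarrow> x i = y i"
    have *: "snd p' x = snd p' y" if "p' \<in> K" "fst p' \<inter> fst p = {}" for p'
      using ty[OF that(1)] that(2) eq by (intro mform_cong[of "fst p'" "snd p'"]) auto
    have "p' \<in> atom K x \<and> fst p' \<inter> fst p = {} \<longleftrightarrow> p' \<in> atom K y \<and> fst p' \<inter> fst p = {}" for p'
      using *[of p'] by (cases "p' \<in> K \<and> fst p' \<inter> fst p = {}") (simp add: atom_def, unfold atom_def, blast)
    then show "insert p {p' \<in> atom K x. fst p' \<inter> fst p = {}} = insert p {p' \<in> atom K y. fst p' \<inter> fst p = {}}"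
      by simp
  next
    fix i p' and x :: "'i \<Rightarrow> 'a" and a b assume i: "i \<in> V - fst p" and p': "p' \<in> K"
    let ?A = "\<lambda>x. insert p {p' \<in> atom K x. fst p' \<inter> fst p = {}}"
    show "if i \<in> fst p' then p' \<in> ?A (x(i := a + b)) \<longleftrightarrow> (p' \<in> ?A (x(i := a))) \<noteq> (p' \<in> ?A (x(i := b)))
      else (p' \<in> ?A (x(i := a)) \<longleftrightarrow> p' \<in> ?A (x(i := a + b))) \<and> (p' \<in> ?A (x(i := b)) \<longleftrightarrow> p' \<in> ?A (x(i := a + b)))"
      using atom_additive[OF K p', of i x a b] i by (cases "p' = p") (simp_all split: if_splits, blast+)
  qed blast
  have T': "T x = (\<Sum>p\<in>B. snd p x * g p x)" if "x \<in> PiE V E" for x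
  proof -
    have "T x = G (atom K x \<inter> B \<union> (atom K x - B))" using T[OF that] by (simp add: Int_Diff_Un)
    also have "\<dots> = (\<Sum>p\<in>atom K x \<inter> B. G (insert p (atom K x - B)))"
      by (rule split) (use atom_subset in fastforce)+
    also have "\<dots> = (\<Sum>p\<in>atom K x \<inter> B. g p x)"
    proof (rule sum.cong[OF refl])
      fix p assume "p \<in> atom K x \<inter> B"
      then have p: "p \<in> B" by simp
      have "finite (fst p)" using ty(1)[of p] p BK V finite_subset by blast
      then have "G (insert p (atom K x - B)) = G (insert p {p' \<in> atom K x - B. fst p' \<inter> fst p = {}})"
        using atom_subset by (intro reduce[OF p]) fastforce+
      also have "{p' \<in> atom K x - B. fst p' \<inter> fst p = {}} = {p' \<in> atom K x. fst p' \<inter> fst p = {}}"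
        using p by (auto simp: B_def)
      finally show "G (insert p (atom K x - B)) = g p x" by (simp add: g_def)
    qed
    also have "\<dots> = (\<Sum>p\<in>B. snd p x * g p x)"
      using fB BK by (intro sum.mono_neutral_cong_left) (auto simp: atom_def)
    finally show ?thesis .
  qed
  define R where "R = (\<lambda>p. (fst p, snd p, g p)) ` B"
  have inj: "inj_on (\<lambda>p. (fst p, snd p, g p)) B" by (auto simp: inj_on_def prod_eq_iff)
  show ?thesis unfolding partition_rank_le_def
  proof (intro exI[of _ R] conjI ballI)
    show "finite R" using fB by (simp add: R_def)
    show "card R \<le> card K" using card_image_le[OF fB] card_mono[OF fK BK] unfolding R_def by (rule order.trans)
    fix x assume "x \<in> PiE V E"
    then show "T x = (\<Sum>(I, f, g)\<in>R. f x * g x)"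
      unfolding R_def by (subst sum.reindex[OF inj]) (simp add: T')
  next
    fix t assume "t \<in> R"
    then obtain p where "p \<in> B" "t = (fst p, snd p, g p)" by (auto simp: R_def)
    then show "case t of (I, f, g) \<Rightarrow> I \<subset> V \<and> I \<noteq> {} \<and> mform I f \<and> mform (V - I) g"
      using ty[of p] form_g[of p] BK by auto
  qed
qed

end

section \<open>Approximation of biased forms\<close>

context coord_groups
begin

text \<open>For fixed x the point x + y is uniform in y, so \<open>w y x\<close> has mean
  \<open>bias V T * sg (T x)\<close> and variance at most 1. The points are chosen one at a time,
  each no worse than average, so the mean square deviation grows by at most 1 per point.\<close>

lemma exists_sample:
  assumes V: "finite V" and T: "mform V T"
  defines "w \<equiv> \<lambda>y x. sg (T x) * sg (T (override_on y (\<lambda>i. x i + y i) V))"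
  shows "\<exists>ys. length ys = m \<and> set ys \<subseteq> PiE V E \<and>
    avg (PiE V E) (\<lambda>x. ((\<Sum>y\<leftarrow>ys. w y x) - m * bias V T * sg (T x))\<^sup>2) \<le> m"
proof (induction m)
  case 0
  then show ?case by (simp add: avg_def)
next
  case (Suc m)
  let ?\<Omega> = "PiE V E" and ?\<beta> = "bias V T"
  have fin: "finite ?\<Omega>" "?\<Omega> \<noteq> {}" using finite_PiE_E V PiE_E_nonempty by blast+
  obtain ys where ys: "length ys = m" "set ys \<subseteq> ?\<Omega>"
    "avg ?\<Omega> (\<lambda>x. ((\<Sum>y\<leftarrow>ys. w y x) - m * ?\<beta> * sg (T x))\<^sup>2) \<le> m" using Suc by blast
  define a where "a = (\<lambda>x. (\<Sum>y\<leftarrow>ys. w y x) - m * ?\<beta> * sg (T x))"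
  define Z where "Z = (\<lambda>y. avg ?\<Omega> (\<lambda>x. (a x + (w y x - ?\<beta> * sg (T x)))\<^sup>2))"
  have mean: "avg ?\<Omega> (\<lambda>y. w y x) = ?\<beta> * sg (T x)" if "x \<in> ?\<Omega>" for x
    using avg_bij[OF bij_corner[OF V that subset_refl], of "\<lambda>y. sg (T y)"]
    by (simp add: w_def avg_cmult bias_def)
  have "avg ?\<Omega> Z = avg ?\<Omega> (\<lambda>x. avg ?\<Omega> (\<lambda>y. (a x + (w y x - ?\<beta> * sg (T x)))\<^sup>2))"
    unfolding Z_def by (rule avg_swap)
  also have "\<dots> = avg ?\<Omega> (\<lambda>x. (a x)\<^sup>2 + (1 - ?\<beta>\<^sup>2))"
  proof (rule avg_cong)
    fix x assume x: "x \<in> ?\<Omega>"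
    have "(a x + (w y x - ?\<beta> * sg (T x)))\<^sup>2 =
      ((a x)\<^sup>2 + 1 + ?\<beta>\<^sup>2 - 2 * a x * ?\<beta> * sg (T x)) + w y x * (2 * a x - 2 * ?\<beta> * sg (T x))" for y
    proof -
      have "w y x * w y x = 1" "sg (T x) * sg (T x) = 1" by (simp_all add: w_def sg_def)
      then show ?thesis by algebra
    qed
    then have "avg ?\<Omega> (\<lambda>y. (a x + (w y x - ?\<beta> * sg (T x)))\<^sup>2) =
      ((a x)\<^sup>2 + 1 + ?\<beta>\<^sup>2 - 2 * a x * ?\<beta> * sg (T x)) + ?\<beta> * sg (T x) * (2 * a x - 2 * ?\<beta> * sg (T x))"
      by (simp only: avg_add avg_multc avg_const[OF fin] mean[OF x])
    also have "\<dots> = (a x)\<^sup>2 + (1 - ?\<beta>\<^sup>2)"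
      using sg_mult_self[of "T x"] by algebra
    finally show "avg ?\<Omega> (\<lambda>y. (a x + (w y x - ?\<beta> * sg (T x)))\<^sup>2) = (a x)\<^sup>2 + (1 - ?\<beta>\<^sup>2)" .
  qed
  also have "\<dots> = avg ?\<Omega> (\<lambda>x. (a x)\<^sup>2) + (1 - ?\<beta>\<^sup>2)" by (simp only: avg_add avg_const[OF fin])
  also have "\<dots> \<le> real m + 1"
  proof -
    have "avg ?\<Omega> (\<lambda>x. (a x)\<^sup>2) \<le> real m" using ys(3) by (simp only: a_def)
    then show ?thesis using zero_le_power2[of ?\<beta>] by linarith
  qed
  finally have "avg ?\<Omega> Z \<le> Suc m" by simp
  then obtain y where y: "y \<in> ?\<Omega>" "Z y \<le> Suc m" using avg_exists_le[OF fin, of Z] by force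
  have "avg ?\<Omega> (\<lambda>x. ((\<Sum>y\<leftarrow>y # ys. w y x) - Suc m * ?\<beta> * sg (T x))\<^sup>2) = Z y"
    unfolding Z_def a_def by (intro avg_cong) (simp add: algebra_simps)
  then show ?case using y ys by (intro exI[of _ "y # ys"]) simp
qed

text \<open>\<open>w y x\<close> is the sign of T(x + y) + T(x), in which the top term T(x) cancels,
  leaving restrictions of T to proper subsets of the variables; these make up K. F is the sign of
  the sampled sum. Where F is wrong the sum is off its mean by at least m times the bias, so
  Chebyshev bounds the error by \<open>1 / (m * \<eta>\<^sup>2)\<close>.\<close>

lemma form_family_approximation:
  assumes V: "finite V" and T: "mform V T" and \<eta>: "0 < \<eta>" "\<eta> \<le> bias V T"
    and m: "1 \<le> \<epsilon> * real m * \<eta>\<^sup>2"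
  shows "\<exists>K F. form_family V K \<and> card K \<le> m * 2 ^ card V \<and>
    (\<forall>x y. atom K x = atom K y \<longrightarrow> F x = F y) \<and> avg (PiE V E) (\<lambda>x. of_bool (F x \<noteq> T x)) \<le> \<epsilon>"
proof -
  let ?\<Omega> = "PiE V E" and ?\<beta> = "bias V T"
  define w where "w = (\<lambda>y x. sg (T x) * sg (T (override_on y (\<lambda>i. x i + y i) V)))"
  obtain ys where ys: "length ys = m" "set ys \<subseteq> ?\<Omega>"
    "avg ?\<Omega> (\<lambda>x. ((\<Sum>y\<leftarrow>ys. w y x) - m * ?\<beta> * sg (T x))\<^sup>2) \<le> m"
    using exists_sample[OF V T, of m] unfolding w_def by blast
  define K where "K = (\<lambda>(y, I). (I, \<lambda>x. T (override_on y x I))) ` (set ys \<times> {I. I \<subset> V \<and> I \<noteq> {}})"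
  define F :: "('i \<Rightarrow> 'a) \<Rightarrow> bit" where "F = (\<lambda>x. if 0 \<le> (\<Sum>y\<leftarrow>ys. w y x) then 0 else 1)"
  have fI: "finite {I. I \<subset> V \<and> I \<noteq> {}}" using V by (auto intro: finite_subset[of _ "Pow V"])
  have K: "form_family V K"
    using fI T by (auto simp: form_family_def K_def intro!: mform_override)
  have "card K \<le> card (set ys \<times> {I. I \<subset> V \<and> I \<noteq> {}})" unfolding K_def using fI by (intro card_image_le) auto
  also have "\<dots> \<le> length ys * card (Pow V)"
    unfolding card_cartesian_product using V by (intro mult_mono card_length card_mono) auto
  finally have cK: "card K \<le> m * 2 ^ card V" using ys V by (simp add: card_Pow)
  have w_eq: "w y x = sg (\<Sum>I\<in>Pow V - {V}. T (override_on y x I))" for y x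
  proof -
    have "T (override_on y (\<lambda>i. x i + y i) V) = (\<Sum>I\<in>Pow V. T (override_on y x I))"
      by (rule mform_expand[OF T V subset_refl])
    also have "\<dots> = T (override_on y x V) + (\<Sum>I\<in>Pow V - {V}. T (override_on y x I))"
      using V by (intro sum.remove) auto
    also have "T (override_on y x V) = T x" by (rule mform_cong[OF T]) simp
    finally show ?thesis unfolding w_def sg_add[symmetric] by simp
  qed
  have det: "F x = F x'" if "atom K x = atom K x'" for x x'
  proof -
    have "w y x = w y x'" if y: "y \<in> set ys" for y
      unfolding w_eq
    proof (rule arg_cong[where f = sg], rule sum.cong[OF refl])
      \<comment> \<open>The empty set contributes the constant T y, which K need not record.\<close>
      fix I assume I: "I \<in> Pow V - {V}"
      show "T (override_on y x I) = T (override_on y x' I)"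
      proof (cases "I = {}")
        case False
        let ?p = "(I, \<lambda>x. T (override_on y x I))"
        have "?p \<in> K" using I False y by (auto simp: K_def)
        moreover have "?p \<in> atom K x \<longleftrightarrow> ?p \<in> atom K x'" using \<open>atom K x = atom K x'\<close> by simp
        ultimately have "T (override_on y x I) = 1 \<longleftrightarrow> T (override_on y x' I) = 1" by (simp add: atom_def)
        then show ?thesis by (rule bit_eqI)
      qed simp
    qed
    then have "map (\<lambda>y. w y x) ys = map (\<lambda>y. w y x') ys" by simp
    then show ?thesis unfolding F_def by metis
  qed
  have \<beta>: "0 < ?\<beta>" using \<eta> by simp
  have mpos: "0 < real m" using m by (cases m) auto
  have "avg ?\<Omega> (\<lambda>x. of_bool (F x \<noteq> T x))
    \<le> avg ?\<Omega> (\<lambda>x. ((\<Sum>y\<leftarrow>ys. w y x) - m * ?\<beta> * sg (T x))\<^sup>2 * (1 / (m * ?\<beta>)\<^sup>2))"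
  proof (rule avg_mono)
    fix x
    let ?S = "\<Sum>y\<leftarrow>ys. w y x"
    show "of_bool (F x \<noteq> T x) \<le> (?S - m * ?\<beta> * sg (T x))\<^sup>2 * (1 / (m * ?\<beta>)\<^sup>2)"
    proof (cases "F x = T x")
      case False
      have "(m * ?\<beta>)\<^sup>2 \<le> (?S - m * ?\<beta> * sg (T x))\<^sup>2"
      proof -
        have "0 < m * ?\<beta>" using mpos \<beta> by simp
        then have "\<bar>m * ?\<beta>\<bar> \<le> \<bar>?S - m * ?\<beta> * sg (T x)\<bar>"
          using False by (cases "T x") (auto simp: F_def split: if_splits)
        then show ?thesis by (simp only: abs_le_square_iff)
      qed
      then show ?thesis using False mpos \<beta> by (simp add: divide_simps)
    qed simp
  qed
  also have "\<dots> \<le> m * (1 / (m * ?\<beta>)\<^sup>2)"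
    unfolding avg_multc using ys(3) by (intro mult_right_mono) auto
  also have "\<dots> = 1 / (m * ?\<beta>\<^sup>2)" using mpos by (simp add: power2_eq_square)
  also have "\<dots> \<le> 1 / (m * \<eta>\<^sup>2)"
    using mpos \<eta> by (intro divide_left_mono mult_left_mono power_mono) auto
  also have "\<dots> \<le> \<epsilon>" using m mpos \<eta> by (simp add: divide_le_eq mult.assoc)
  finally show ?thesis using K cK det by blast
qed

end

section \<open>Regularization, and partition rank of biased forms\<close>

abbreviation type_sizes :: "('i, 'a) typed_form set \<Rightarrow> nat multiset" where
  "type_sizes K \<equiv> image_mset (\<lambda>p. card (fst p)) (mset_set K)"

lemma image_mset_set_subseteq_replicate:
  assumes "finite N" "card N \<le> b" "\<And>p. p \<in> N \<Longrightarrow> h p < (s :: nat)"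
  shows "image_mset h (mset_set N) \<subseteq># (\<Sum>t<s. replicate_mset b t)"
proof (rule mset_subset_eqI)
  fix t
  have "count (image_mset h (mset_set N)) t \<le> (if t < s then b else 0)"
  proof (cases "t < s")
    case True
    have "count (image_mset h (mset_set N)) t \<le> size (image_mset h (mset_set N))" by (rule count_le_size)
    then show ?thesis using True assms(1,2) by simp
  next
    case False
    then have "t \<notin># image_mset h (mset_set N)" using assms(1,3) by auto
    then have "count (image_mset h (mset_set N)) t = 0" unfolding not_in_iff .
    then show ?thesis using False by linarith
  qed
  also have "\<dots> = count (\<Sum>t<s. replicate_mset b t) t"
    by (simp add: count_sum sum.delta)
  finally show "count (image_mset h (mset_set N)) t \<le> count (\<Sum>t<s. replicate_mset b t) t" .
qed

text \<open>Given an irregular combination of forms of type \<open>I\<close>, one of these forms is replaced by boundedly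
  many forms on proper subsets of \<open>I\<close>; the multiset of the sizes of the types decreases.\<close>
lemma (in coord_groups) regularity_step:
  assumes V: "finite V" and K: "form_family V K" and c: "c \<subseteq> K" "p0 \<in> c" "\<forall>p\<in>c. fst p = I"
    and rank: "partition_rank_le I (\<lambda>x. \<Sum>p\<in>c. snd p x) b"
  shows "\<exists>K'. form_family V K' \<and>
    type_sizes K' \<subseteq># (type_sizes K - {#card I#}) + (\<Sum>t<card I. replicate_mset (2 * b) t) \<and>
    (\<forall>x\<in>PiE V E. \<forall>y\<in>PiE V E. atom K' x = atom K' y \<longrightarrow> atom K x = atom K y)"
proof -
  obtain R where R: "finite R" "card R \<le> b"
    and R1: "\<And>J f g. (J, f, g) \<in> R \<Longrightarrow> J \<subset> I \<and> J \<noteq> {} \<and> mform J f \<and> mform (I - J) g"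
    and R2: "\<And>x. x \<in> PiE I E \<Longrightarrow> (\<Sum>p\<in>c. snd p x) = (\<Sum>(J, f, g)\<in>R. f x * g x)"
    using rank unfolding partition_rank_le_def by fast
  have fK: "finite K" using K by (simp add: form_family_def)
  then have fc: "finite c" using c finite_subset by blast
  have p0: "p0 \<in> K" "fst p0 = I" using c by auto
  have I: "I \<subset> V" "finite I" using p0 K V finite_subset unfolding form_family_def by (blast, blast)
  \<comment> \<open>Both factors of each product are adjoined, whence 2 * b.\<close>
  define N where "N = (\<lambda>(J, f, g). (J, f)) ` R \<union> (\<lambda>(J, f, g). (I - J, g)) ` R"
  define K' where "K' = (K - {p0}) \<union> N"
  have fN: "finite N" using R by (simp add: N_def)
  have "card N \<le> card R + card R" unfolding N_def
    by (intro order.trans[OF card_Un_le] add_mono card_image_le R)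
  then have cN: "card N \<le> 2 * b" using R by simp
  have N: "fst p \<subset> I \<and> fst p \<noteq> {} \<and> mform (fst p) (snd p)" if "p \<in> N" for p
  proof -
    from that obtain J f g where *: "(J, f, g) \<in> R" "p = (J, f) \<or> p = (I - J, g)" by (auto simp: N_def)
    then show ?thesis using R1[OF *(1)] by auto
  qed
  have K': "form_family V K'"
    unfolding form_family_def
  proof (intro conjI ballI)
    show "finite K'" using fK fN by (simp add: K'_def)
    fix p assume "p \<in> K'"
    then have "p \<in> K \<or> p \<in> N" by (auto simp: K'_def)
    then have "fst p \<subset> V \<and> fst p \<noteq> {} \<and> mform (fst p) (snd p)"
      using K N[of p] I unfolding form_family_def by blast
    then show "fst p \<subset> V" "fst p \<noteq> {}" "mform (fst p) (snd p)" by auto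
  qed
  have sizes: "type_sizes K' \<subseteq># (type_sizes K - {#card I#}) + (\<Sum>t<card I. replicate_mset (2 * b) t)"
  proof -
    have "mset_set K' \<subseteq># mset_set (K - {p0}) + mset_set N"
      using fK fN by (intro mset_subset_eqI) (auto simp: K'_def count_mset_set')
    then have "type_sizes K' \<subseteq># type_sizes (K - {p0}) + type_sizes N"
      using image_mset_subseteq_mono by fastforce
    also have "type_sizes (K - {p0}) = type_sizes K - {#card I#}"
      using fK p0 by (simp add: mset_set_Diff image_mset_Diff)
    finally have "type_sizes K' \<subseteq># type_sizes K - {#card I#} + type_sizes N" .
    moreover have "type_sizes N \<subseteq># (\<Sum>t<card I. replicate_mset (2 * b) t)"
      using N I by (intro image_mset_set_subseteq_replicate fN cN psubset_card_mono) auto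
    ultimately show ?thesis by (meson subset_mset.add_left_mono subset_mset.order_trans)
  qed
  have "atom K x = atom K y" if xy: "x \<in> PiE V E" "y \<in> PiE V E" "atom K' x = atom K' y" for x y
  proof -
    have same: "snd p x = snd p y" if "p \<in> K'" for p
    proof (rule bit_eqI)
      have "p \<in> atom K' x \<longleftrightarrow> p \<in> atom K' y" using xy(3) by simp
      then show "snd p x = 1 \<longleftrightarrow> snd p y = 1" using that by (simp add: atom_def)
    qed
    have expr: "snd p0 z = (\<Sum>(J, f, g)\<in>R. f z * g z) + (\<Sum>p\<in>c - {p0}. snd p z)" if z: "z \<in> PiE V E" for z
    proof -
      have mc: "mform (fst p) (snd p)" "fst p = I" if "p \<in> c" for p
        using c(1) K that unfolding form_family_def by (blast, intro bspec[OF c(3)])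
      \<comment> \<open>The rank identity is known only for extensional arguments on I.\<close>
      have zI: "restrict z I \<in> PiE I E" using z I by auto
      have "(\<Sum>p\<in>c. snd p z) = (\<Sum>p\<in>c. snd p (restrict z I))"
        by (intro sum.cong refl mform_cong[OF mc(1)]) (auto simp: mc(2))
      also have "\<dots> = (\<Sum>(J, f, g)\<in>R. f (restrict z I) * g (restrict z I))" by (rule R2[OF zI])
      also have "\<dots> = (\<Sum>(J, f, g)\<in>R. f z * g z)"
      proof (rule sum.cong[OF refl], clarify)
        fix J f g assume r: "(J, f, g) \<in> R"
        have "f (restrict z I) = f z" by (rule mform_cong[of J]) (use R1[OF r] in auto)
        moreover have "g (restrict z I) = g z" by (rule mform_cong[of "I - J"]) (use R1[OF r] in auto)
        ultimately show "f (restrict z I) * g (restrict z I) = f z * g z" by simp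
      qed
      finally have "(\<Sum>(J, f, g)\<in>R. f z * g z) = snd p0 z + (\<Sum>p\<in>c - {p0}. snd p z)"
        using sum.remove[OF fc c(2), of "\<lambda>p. snd p z"] by simp
      then show ?thesis by (simp add: add.commute add.left_commute)
    qed
    have "(\<Sum>(J, f, g)\<in>R. f x * g x) = (\<Sum>(J, f, g)\<in>R. f y * g y)"
    proof (rule sum.cong[OF refl], clarify)
      fix J f g assume "(J, f, g) \<in> R"
      then have "(J, f) \<in> K'" "(I - J, g) \<in> K'" by (force simp: K'_def N_def)+
      then show "f x * g x = f y * g y" using same[of "(J, f)"] same[of "(I - J, g)"] by simp
    qed
    moreover have "(\<Sum>p\<in>c - {p0}. snd p x) = (\<Sum>p\<in>c - {p0}. snd p y)"
      using c by (intro sum.cong refl same) (auto simp: K'_def)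
    ultimately have "snd p0 x = snd p0 y" using expr xy by simp
    then have "snd p x = snd p y" if "p \<in> K" for p
      using same[of p] that by (cases "p = p0") (auto simp: K'_def)
    then show ?thesis unfolding atom_def by (intro Collect_cong conj_cong refl) simp
  qed
  then show ?thesis using K' sizes by blast
qed

text \<open>The induction runs over a multiset m bounding the type sizes, in the multiset order, and
  not over K: the resulting N has to serve all groups and all families below m. The threshold \<phi>
  may depend on the size of the family finally reached.\<close>

lemma regular_refinement:
  fixes \<phi> :: "nat \<Rightarrow> real" and b :: "nat \<Rightarrow> nat" and m :: "nat multiset"
  assumes rank: "\<And>(E :: 'i \<Rightarrow> 'a::ab_group_add set) I T M. coord_groups E \<Longrightarrow> finite I \<Longrightarrow> I \<noteq> {} \<Longrightarrow> card I < D \<Longrightarrow>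
      mform I T \<Longrightarrow> \<phi> M < coord_groups.bias E I T \<Longrightarrow> coord_groups.partition_rank_le E I T (b M)"
    and mono: "\<And>M M'. M \<le> M' \<Longrightarrow> b M \<le> b M'"
  shows "\<exists>N. \<forall>(E :: 'i \<Rightarrow> 'a set) V K. coord_groups E \<longrightarrow> finite V \<longrightarrow> card V = D \<longrightarrow> form_family V K \<longrightarrow>
      type_sizes K \<subseteq># m \<longrightarrow>
      (\<exists>K'. form_family V K' \<and> card K' \<le> N \<and> coord_groups.regular E (\<phi> (card K')) K' \<and>
        (\<forall>x\<in>PiE V E. \<forall>y\<in>PiE V E. atom K' x = atom K' y \<longrightarrow> atom K x = atom K y))"
    (is "\<exists>N. ?P m N")
proof (induction m rule: wf_induct_rule[OF wf_mult[OF wf_less_than]])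
  case (1 m)
  \<comment> \<open>One size s is traded for copies of all smaller sizes. Their number uses
    \<open>size m\<close>, which bounds \<open>card K\<close>; monotonicity of b makes this
    uniform.\<close>
  define m' where "m' = (\<lambda>s. (m - {#s#}) + (\<Sum>t<s. replicate_mset (2 * b (size m)) t))"
  have *: "\<exists>N. ?P (m' s) N" if s: "s \<in># m" for s
  proof (rule 1)
    have "(m' s, (m - {#s#}) + {#s#}) \<in> mult less_than"
      unfolding m'_def by (rule one_step_implies_mult) (auto simp: set_mset_sum)
    then show "(m' s, m) \<in> mult less_than" using s by simp
  qed
  have "\<forall>s\<in>set_mset m. \<exists>N. ?P (m' s) N" by (rule ballI) (rule *)
  from bchoice[OF this] obtain Nf where Nf: "\<forall>s\<in>set_mset m. ?P (m' s) (Nf s)" ..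
  \<comment> \<open>Which s is removed depends on the family, so the bound adds up the bounds for
    all s in m.\<close>
  show ?case
  proof (intro exI[of _ "size m + (\<Sum>s\<in>set_mset m. Nf s)"] allI impI)
    fix E :: "'i \<Rightarrow> 'a set" and V and K :: "('i, 'a) typed_form set"
    assume E: "coord_groups E" and V: "finite V" "card V = D" and K: "form_family V K" and sz: "type_sizes K \<subseteq># m"
    interpret coord_groups E by (rule E)
    have fK: "finite K" using K by (simp add: form_family_def)
    have cK: "card K \<le> size m" using size_mset_mono[OF sz] by simp
    show "\<exists>K' :: ('i, 'a) typed_form set. form_family V K' \<and> card K' \<le> size m + (\<Sum>s\<in>set_mset m. Nf s) \<and> regular (\<phi> (card K')) K' \<and>
        (\<forall>x\<in>PiE V E. \<forall>y\<in>PiE V E. atom K' x = atom K' y \<longrightarrow> atom K x = atom K y)"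
    proof (cases "regular (\<phi> (card K)) K")
      case True
      then show ?thesis using K cK by (intro exI[of _ K]) auto
    next
      case False
      then obtain c I where c: "c \<subseteq> K" "c \<noteq> {}" "\<forall>p\<in>c. fst p = I"
        and "\<not> bias I (\<lambda>x. \<Sum>p\<in>c. snd p x) \<le> \<phi> (card K)"
        unfolding regular_def not_all not_imp by (elim exE conjE)
      then have big: "\<phi> (card K) < bias I (\<lambda>x. \<Sum>p\<in>c. snd p x)" by simp
      obtain p0 where p0: "p0 \<in> c" using c by blast
      have p0K: "p0 \<in> K" "fst p0 = I" using c p0 by auto
      have I: "I \<subset> V" "I \<noteq> {}" using p0K K by (auto simp: form_family_def)
      have fI: "finite I" using I V finite_subset by blast
      have "mform I (\<lambda>x. \<Sum>p\<in>c. snd p x)"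
      proof (rule mform_sum)
        fix p assume "p \<in> c"
        then have "fst p = I" "mform (fst p) (snd p)" using c K unfolding form_family_def by (blast, blast)
        then show "mform I (snd p)" by simp
      qed
      then have r: "partition_rank_le I (\<lambda>x. \<Sum>p\<in>c. snd p x) (b (card K))"
        using I V fI by (intro rank[OF E _ _ _ _ big]) (auto intro: psubset_card_mono)
      from regularity_step[OF V(1) K c(1) p0 c(3) r]
      obtain K1 where K1: "form_family V K1"
        "type_sizes K1 \<subseteq># (type_sizes K - {#card I#}) + (\<Sum>t<card I. replicate_mset (2 * b (card K)) t)"
        "\<forall>x\<in>PiE V E. \<forall>y\<in>PiE V E. atom K1 x = atom K1 y \<longrightarrow> atom K x = atom K y"
        by (elim exE conjE)
      have s: "card I \<in># m"
      proof -
        have "card I \<in># type_sizes K" using p0K fK by auto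
        then show ?thesis using sz by (rule mset_subset_eqD[rotated])
      qed
      have sz1: "type_sizes K1 \<subseteq># m' (card I)"
      proof -
        have "(\<Sum>t<card I. replicate_mset (2 * b (card K)) t) \<subseteq># (\<Sum>t<card I. replicate_mset (2 * b (size m)) t)"
          using mono[OF cK] by (intro mset_subset_eqI) (simp add: count_sum sum.delta)
        moreover have "type_sizes K - {#card I#} \<subseteq># m - {#card I#}"
          using mset_subset_eq_count[OF sz] by (intro mset_subset_eqI) (simp add: diff_le_mono)
        ultimately have "(type_sizes K - {#card I#}) + (\<Sum>t<card I. replicate_mset (2 * b (card K)) t) \<subseteq># m' (card I)"
          unfolding m'_def by (intro subset_mset.add_mono)
        then show ?thesis using K1(2) by (rule subset_mset.order_trans[rotated])
      qed
      from bspec[OF Nf s, rule_format, OF E V K1(1) sz1]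
      obtain K' where K': "form_family V K'" "card K' \<le> Nf (card I)" "regular (\<phi> (card K')) K'"
        "\<forall>x\<in>PiE V E. \<forall>y\<in>PiE V E. atom K' x = atom K' y \<longrightarrow> atom K1 x = atom K1 y"
        by (elim exE conjE)
      have "Nf (card I) \<le> (\<Sum>s\<in>set_mset m. Nf s)" using s by (intro member_le_sum) auto
      then have "card K' \<le> size m + (\<Sum>s\<in>set_mset m. Nf s)" using K'(2) by linarith
      moreover have "\<forall>x\<in>PiE V E. \<forall>y\<in>PiE V E. atom K' x = atom K' y \<longrightarrow> atom K x = atom K y"
      proof (intro ballI impI)
        fix x y assume *: "x \<in> PiE V E" "y \<in> PiE V E" "atom K' x = atom K' y"
        show "atom K x = atom K y" by (rule K1(3)[rule_format, OF *(1,2) K'(4)[rule_format, OF *]])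
      qed
      ultimately show ?thesis using K'(1,3) by (intro exI[of _ K'] conjI)
    qed
  qed
qed

text \<open>No base case is needed: in one variable there are no nonempty proper types, so every
  family is empty. The groups are quantified inside the bound, since the induction hypothesis is
  used for forms on arbitrary subsets of the variables.\<close>

theorem biased_form_partition_rank:
  fixes D :: nat and \<eta> :: real
  assumes "0 < \<eta>"
  shows "\<exists>n. \<forall>(E :: 'i \<Rightarrow> 'a::ab_group_add set) V T. coord_groups E \<longrightarrow> finite V \<longrightarrow> V \<noteq> {} \<longrightarrow> card V = D \<longrightarrow>
    mform V T \<longrightarrow> \<eta> \<le> coord_groups.bias E V T \<longrightarrow> coord_groups.partition_rank_le E V T n"
  using assms
proof (induction D arbitrary: \<eta> rule: less_induct)
  case (less D)
  \<comment> \<open>M stands for the size of the regular family. \<open>M * 2 ^ D\<close> bounds its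
    number of mixed terms, M accounts for the mass of an atom, D for \<open>mform_few_ones\<close>,
    and 4 for the constant 1/16. The power \<open>2 ^ D\<close> in \<phi> is the loss in the Gowers
    inequality.\<close>
  define \<theta> :: "nat \<Rightarrow> real" where "\<theta> = (\<lambda>M. (1 / 2) ^ (M * 2 ^ D + M + D + 4))"
  define \<phi> :: "nat \<Rightarrow> real" where "\<phi> = (\<lambda>M. \<theta> M ^ (2 ^ D))"
  have \<phi>: "0 < \<phi> M" for M by (simp add: \<phi>_def \<theta>_def)
  let ?Q = "\<lambda>s M n. \<forall>(E :: 'i \<Rightarrow> 'a set) V T. coord_groups E \<longrightarrow> finite V \<longrightarrow> V \<noteq> {} \<longrightarrow> card V = s \<longrightarrow>
    mform V T \<longrightarrow> \<phi> M \<le> coord_groups.bias E V T \<longrightarrow> coord_groups.partition_rank_le E V T n"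
  define nn where "nn = (\<lambda>s M. SOME n. ?Q s M n)"
  have nn: "coord_groups.partition_rank_le E V T (nn s M)"
    if "s < D" "coord_groups E" "finite V" "V \<noteq> {}" "card V = s" "mform V T" "\<phi> M \<le> coord_groups.bias E V T"
    for s M V T and E :: "'i \<Rightarrow> 'a set"
  proof -
    have "?Q s M (nn s M)" unfolding nn_def by (rule someI_ex, rule less.IH[OF that(1) \<phi>])
    then show ?thesis using that(2-) by blast
  qed
  \<comment> \<open>Summation makes the bound monotone in M and valid for every smaller number of
    variables.\<close>
  define b where "b = (\<lambda>M. \<Sum>M'\<le>M. \<Sum>s<D. nn s M')"
  have b_mono: "b M \<le> b M'" if "M \<le> M'" for M M'
    unfolding b_def using that by (intro sum_mono2) auto
  have rank_mono: "coord_groups.partition_rank_le E V T n'" if "coord_groups E" "coord_groups.partition_rank_le E V T n" "n \<le> n'"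
    for E :: "'i \<Rightarrow> 'a set" and V T n n'
    using that unfolding coord_groups.partition_rank_le_def[OF that(1)] by (meson order.trans)
  have nn_le: "nn s M \<le> b M" if "s < D" for s M
  proof -
    have "nn s M \<le> (\<Sum>s<D. nn s M)" using that by (intro member_le_sum[where f = "\<lambda>s. nn s M"]) auto
    also have "\<dots> \<le> b M" unfolding b_def
      by (intro member_le_sum[where f = "\<lambda>M. \<Sum>s<D. nn s M"]) auto
    finally show ?thesis .
  qed
  \<comment> \<open>One factor \<open>(1 / 2) ^ D\<close> pays for the union bound over corners, the
    other for \<open>mform_few_ones\<close>.\<close>
  define \<epsilon> :: real where "\<epsilon> = (1 / 4) ^ D / 16"
  have \<epsilon>: "0 < \<epsilon>" "2 ^ D * \<epsilon> \<le> (1 / 2) ^ D / 16"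
    by (simp_all add: \<epsilon>_def power_mult_distrib[symmetric])
  obtain m :: nat where m: "1 / (\<epsilon> * \<eta>\<^sup>2) \<le> m" using real_arch_simple by blast
  have m': "1 \<le> \<epsilon> * real m * \<eta>\<^sup>2"
    using m \<epsilon>(1) less.prems by (simp add: divide_le_eq ac_simps)
  \<comment> \<open>The initial family has at most \<open>m * 2 ^ D\<close> members, so also at most
    that many of each size.\<close>
  define m0 where "m0 = (\<Sum>t<D. replicate_mset (m * 2 ^ D) t)"
  obtain N where N: "\<And>(E :: 'i \<Rightarrow> 'a set) V K. coord_groups E \<Longrightarrow> finite V \<Longrightarrow> card V = D \<Longrightarrow> form_family V K \<Longrightarrow>
      type_sizes K \<subseteq># m0 \<Longrightarrow>
      (\<exists>K'. form_family V K' \<and> card K' \<le> N \<and> coord_groups.regular E (\<phi> (card K')) K' \<and>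
        (\<forall>x\<in>PiE V E. \<forall>y\<in>PiE V E. atom K' x = atom K' y \<longrightarrow> atom K x = atom K y))"
  proof -
    have "\<exists>N. \<forall>(E :: 'i \<Rightarrow> 'a set) V K. coord_groups E \<longrightarrow> finite V \<longrightarrow> card V = D \<longrightarrow> form_family V K \<longrightarrow>
      type_sizes K \<subseteq># m0 \<longrightarrow>
      (\<exists>K'. form_family V K' \<and> card K' \<le> N \<and> coord_groups.regular E (\<phi> (card K')) K' \<and>
        (\<forall>x\<in>PiE V E. \<forall>y\<in>PiE V E. atom K' x = atom K' y \<longrightarrow> atom K x = atom K y))"
    proof (rule regular_refinement[where b = b])
      fix E :: "'i \<Rightarrow> 'a set" and I T M
      assume *: "coord_groups E" "finite I" "I \<noteq> {}" "card I < D" "mform I T" "\<phi> M < coord_groups.bias E I T"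
      have "coord_groups.partition_rank_le E I T (nn (card I) M)"
        using * by (intro nn) auto
      then show "coord_groups.partition_rank_le E I T (b M)"
        by (rule rank_mono[OF *(1) _ nn_le[OF *(4)]])
    qed (rule b_mono)
    then obtain N where "\<forall>(E :: 'i \<Rightarrow> 'a set) V K. coord_groups E \<longrightarrow> finite V \<longrightarrow> card V = D \<longrightarrow> form_family V K \<longrightarrow>
      type_sizes K \<subseteq># m0 \<longrightarrow>
      (\<exists>K'. form_family V K' \<and> card K' \<le> N \<and> coord_groups.regular E (\<phi> (card K')) K' \<and>
        (\<forall>x\<in>PiE V E. \<forall>y\<in>PiE V E. atom K' x = atom K' y \<longrightarrow> atom K x = atom K y))" ..
    then show thesis by (intro that[of N]) simp
  qed
  show ?case
  proof (intro exI[of _ N] allI impI)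
    fix E :: "'i \<Rightarrow> 'a set" and V T
    assume E: "coord_groups E" and V: "finite V" "V \<noteq> {}" "card V = D" and T: "mform V T"
      and bias: "\<eta> \<le> coord_groups.bias E V T"
    interpret coord_groups E by (rule E)
    obtain K F where K: "form_family V K" "card K \<le> m * 2 ^ card V"
      and F: "\<And>x y. atom K x = atom K y \<Longrightarrow> F x = F y" "avg (PiE V E) (\<lambda>x. of_bool (F x \<noteq> T x)) \<le> \<epsilon>"
      using form_family_approximation[OF V(1) T less.prems bias m'] by blast
    have sz: "type_sizes K \<subseteq># m0" unfolding m0_def
      using K V by (intro image_mset_set_subseteq_replicate) (auto simp: form_family_def intro!: psubset_card_mono)
    from N[OF E V(1,3) K(1) sz]
    obtain K' where K': "form_family V K'" "card K' \<le> N" "regular (\<phi> (card K')) K'"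
      "\<forall>x\<in>PiE V E. \<forall>y\<in>PiE V E. atom K' x = atom K' y \<longrightarrow> atom K x = atom K y"
      by (elim exE conjE)
    let ?\<theta> = "\<theta> (card K')"
    have \<theta>: "0 \<le> ?\<theta>" "?\<theta> \<le> 1" by (simp_all add: \<theta>_def power_le_one)
    have reg: "regular (?\<theta> ^ 2 ^ card V) K'" using K'(3) V by (simp add: \<phi>_def)
    have small: "?\<theta> * 2 ^ (card (mixed_terms K') + card K') \<le> (1 / 2) ^ card V / 16"
    proof -
      have "card (mixed_terms K') \<le> card K' * 2 ^ D" using card_mixed_terms[OF V(1) K'(1)] V by simp
      then have "?\<theta> * 2 ^ (card (mixed_terms K') + card K') \<le> ?\<theta> * 2 ^ (card K' * 2 ^ D + card K')"
        using \<theta> by (intro mult_left_mono power_increasing) auto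
      also have "\<dots> = (1 / 2) ^ (D + 4) * ((1 / 2) ^ (card K' * 2 ^ D + card K') * 2 ^ (card K' * 2 ^ D + card K'))"
        unfolding \<theta>_def by (simp only: power_add mult_ac)
      also have "\<dots> = (1 / 2) ^ D / 16"
        unfolding power_mult_distrib[symmetric] by (simp add: power_add power_divide)
      finally show ?thesis using V by simp
    qed
    have F': "F x = F y" if "x \<in> PiE V E" "y \<in> PiE V E" "atom K' x = atom K' y" for x y
      by (rule F(1)[OF K'(4)[rule_format, OF that]])
    have \<epsilon>V: "2 ^ card V * \<epsilon> \<le> (1 / 2) ^ card V / 16" using \<epsilon>(2) V by simp
    note ex = majority_exact[OF V(1) K'(1) reg \<theta> T F' F(2) \<epsilon>V small]
    have "partition_rank_le V T (card K')"
      by (rule block_additive_partition_rank[OF V(1,2) K'(1) ex])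
    then show "partition_rank_le V T N" using K'(2) by (rule rank_mono[OF E])
  qed
qed

section \<open>Tensors over the two-element field\<close>

definition pairing :: "nat set \<Rightarrow> (nat \<Rightarrow> nat) \<Rightarrow> tensor \<Rightarrow> tensor \<Rightarrow> bit" where
  "pairing I n S T = (\<Sum>x\<in>indices I n. S x * T x)"

definition unit_vec :: "'a \<Rightarrow> 'a \<Rightarrow> bit" where
  "unit_vec a = (\<lambda>b. if b = a then 1 else 0)"

lemma sum_apply: "(\<Sum>x\<in>S. f x) y = (\<Sum>x\<in>S. f x y)"
  by (induction S rule: infinite_finite_induct) auto

lemma finite_indices: "finite I \<Longrightarrow> finite (indices I n)"
  by (simp add: indices_def finite_PiE)

lemma finite_bit_functions: "finite S \<Longrightarrow> finite {f :: 'a \<Rightarrow> bit. \<forall>x. x \<notin> S \<longrightarrow> f x = 0}"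
proof -
  assume S: "finite S"
  have "finite (UNIV :: bit set)" by (rule finite_subset[of _ "{0, 1}"]) (auto intro: bit.exhaust)
  from finite_set_of_finite_funs[OF S this, of 0] show ?thesis by simp
qed

lemma finite_tensors: "finite I \<Longrightarrow> finite (tensors I n)"
  unfolding tensors_def by (intro finite_bit_functions finite_indices)

lemma finite_vecs: "finite (vecs m)"
proof -
  have "vecs m = {f. \<forall>j. j \<notin> {..<m} \<longrightarrow> f j = 0}" by (auto simp: vecs_def)
  then show ?thesis using finite_bit_functions[of "{..<m}"] by simp
qed

section \<open>Annihilators with respect to the coordinate pairing\<close>

lemma pairing_add: "pairing I n S (A + B) = pairing I n S A + pairing I n S B"
  by (simp add: pairing_def distrib_left sum.distrib)

lemma pairing_bscale: "pairing I n S (bscale c A) = c * pairing I n S A"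
  by (simp add: pairing_def bscale_def sum_distrib_left mult_ac)

lemma pairing_0: "pairing I n S 0 = 0"
  by (simp add: pairing_def)

lemma subspace_tensors: "F2.subspace (tensors I n)"
  by (auto simp: F2.subspace_def tensors_def bscale_def)

lemma subspace_annihilator:
  "F2.subspace {A \<in> tensors I n. \<forall>r\<in>R. pairing I n (f r) A = 0}"
  using subspace_tensors[of I n] by (auto simp: F2.subspace_def pairing_add pairing_bscale pairing_0)

lemma dim_kernel:
  assumes S: "F2.subspace S" "finite S"
    and L: "\<And>A B. L (A + B) = L A + (L B :: bit)" "\<And>c A. L (bscale c A) = c * L A"
  shows "F2.dim S \<le> F2.dim {A \<in> S. L A = 0} + 1"
proof (cases "\<exists>a\<in>S. L a = 1")
  case False
  then have "{A \<in> S. L A = 0} = S" by auto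
  then show ?thesis by simp
next
  case True
  then obtain a where a: "a \<in> S" "L a = 1" by blast
  let ?H = "{A \<in> S. L A = 0}"
  obtain B where B: "B \<subseteq> ?H" "F2.independent B" "?H \<subseteq> F2.span B" "card B = F2.dim ?H"
    using F2.basis_exists by blast
  have fB: "finite B" by (rule finite_subset[of _ S]) (use B(1) S(2) in auto)
  have "S \<subseteq> F2.span (insert a B)"
  proof
    fix A assume A: "A \<in> S"
    show "A \<in> F2.span (insert a B)"
    proof (cases "L A = 0")
      case True
      then show ?thesis using A B(3) F2.span_mono[of B "insert a B"] by blast
    next
      case False
      then have "L (a + A) = 0" using L(1)[of a A] a by simp
      moreover have "a + A \<in> S" using S(1) a A by (simp add: F2.subspace_add)
      ultimately have "a + A \<in> F2.span (insert a B)" using B(3) F2.span_mono[of B "insert a B"] by blast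
      then have "a + (a + A) \<in> F2.span (insert a B)"
        by (rule F2.span_add[OF F2.span_base[OF insertI1]])
      moreover have "a + (a + A) = A" by (simp add: fun_eq_iff)
      ultimately show ?thesis by simp
    qed
  qed
  then have "F2.dim S \<le> card (insert a B)" using fB by (intro F2.dim_le_card) auto
  also have "\<dots> \<le> card B + 1" using fB by (simp add: card_insert_if)
  finally show ?thesis using B(4) by simp
qed

lemma dim_annihilator:
  assumes I: "finite I" and R: "finite R"
  shows "F2.dim (tensors I n) \<le> F2.dim {A \<in> tensors I n. \<forall>r\<in>R. pairing I n (f r) A = 0} + card R"
  using R
proof (induction R rule: finite_induct)
  case (insert r R)
  let ?S = "{A \<in> tensors I n. \<forall>r\<in>R. pairing I n (f r) A = 0}"
  have "F2.dim ?S \<le> F2.dim {A \<in> ?S. pairing I n (f r) A = 0} + 1"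
    using finite_tensors[OF I]
    by (intro dim_kernel subspace_annihilator pairing_add pairing_bscale) auto
  moreover have "{A \<in> ?S. pairing I n (f r) A = 0} = {A \<in> tensors I n. \<forall>r\<in>insert r R. pairing I n (f r) A = 0}"
    by auto
  ultimately show ?case using insert by simp
qed simp

text \<open>A subspace is its own double annihilator: extend to a functional g that kills a basis of
  V and is 1 at Y, and let b list the values of g on the standard basis.\<close>

lemma exists_separating_tensor:
  assumes I: "finite I" and V: "F2.subspace V" "V \<subseteq> tensors I n" and Y: "Y \<in> tensors I n" "Y \<notin> V"
  shows "\<exists>b\<in>tensors I n. (\<forall>A\<in>V. pairing I n b A = 0) \<and> pairing I n b Y = 1"
proof -
  interpret vp: vector_space_pair "bscale :: bit \<Rightarrow> tensor \<Rightarrow> tensor" "(*) :: bit \<Rightarrow> bit \<Rightarrow> bit"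
    by unfold_locales (simp_all add: algebra_simps)
  obtain B where B: "B \<subseteq> V" "F2.independent B" "V \<subseteq> F2.span B"
    using F2.maximal_independent_subset by blast
  have "F2.span B = V" using B V by (intro F2.span_subspace)
  then have "F2.independent (insert Y B)" using Y B by (intro F2.independent_insertI) auto
  from vp.linear_independent_extend[OF this, of "\<lambda>x. if x = Y then 1 else 0"]
  obtain g where lin: "Vector_Spaces.linear bscale (*) g" and g: "\<forall>x\<in>insert Y B. g x = (if x = Y then 1 else 0)" by blast
  interpret g: Vector_Spaces.linear bscale "(*)" g by (rule lin)
  have g0: "g A = 0" if "A \<in> V" for A
  proof -
    have "A \<in> F2.span B" using that B by blast
    then show ?thesis
    proof (rule vp.linear_eq_0_on_span[OF lin, rotated])
      fix x assume "x \<in> B" then show "g x = 0" using g Y B by auto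
    qed
  qed
  define b where "b = (\<lambda>x. if x \<in> indices I n then g (unit_vec x) else 0)"
  have pair: "pairing I n b A = g A" if A: "A \<in> tensors I n" for A
  proof -
    have "A = (\<Sum>x\<in>indices I n. bscale (A x) (unit_vec x))"
    proof
      fix y
      have "(\<Sum>x\<in>indices I n. bscale (A x) (unit_vec x)) y = (\<Sum>x\<in>indices I n. if x = y then A y else 0)"
        unfolding sum_apply by (intro sum.cong refl) (auto simp: bscale_def unit_vec_def)
      then show "A y = (\<Sum>x\<in>indices I n. bscale (A x) (unit_vec x)) y"
        using A finite_indices[OF I] by (auto simp: tensors_def)
    qed
    then have "g A = g (\<Sum>x\<in>indices I n. bscale (A x) (unit_vec x))" by simp
    also have "\<dots> = (\<Sum>x\<in>indices I n. A x * g (unit_vec x))" by (simp add: g.sum g.scale)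
    also have "\<dots> = pairing I n b A"
      unfolding pairing_def b_def by (intro sum.cong refl) (simp add: mult.commute)
    finally show ?thesis ..
  qed
  show ?thesis
  proof (intro bexI[of _ b] conjI ballI)
    show "b \<in> tensors I n" by (simp add: b_def tensors_def)
    show "pairing I n b Y = 1" using pair[OF Y(1)] g by simp
    fix A assume "A \<in> V" then show "pairing I n b A = 0" using pair[of A] g0 V by auto
  qed
qed

lemma sum_indices_split:
  assumes "I \<subseteq> X"
  shows "(\<Sum>x\<in>indices X n. F (restrict x I) (restrict x (X - I))) = (\<Sum>y\<in>indices I n. \<Sum>z\<in>indices (X - I) n. F y z)"
proof -
  have "(\<Sum>x\<in>indices X n. F (restrict x I) (restrict x (X - I))) = (\<Sum>(y, z)\<in>indices I n \<times> indices (X - I) n. F y z)"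
    by (rule sum.reindex_bij_witness[where i = "\<lambda>(y, z). (\<lambda>i. if i \<in> I then y i else z i)" and j = "\<lambda>x. (restrict x I, restrict x (X - I))"])
      (use assms in \<open>auto simp: indices_def PiE_def Pi_def extensional_def fun_eq_iff split: if_splits\<close>)
  then show ?thesis by (simp add: sum.cartesian_product)
qed

text \<open>On a product tensor the pairing with a product of a and b factorizes, and the factor of
  a vanishes on H; linearity extends this to the span.\<close>

lemma pairing_tensor_space_prod:
  assumes I: "I \<subseteq> X"
    and c: "\<And>x. x \<in> indices X n \<Longrightarrow> c x = a (restrict x I) * b (restrict x (X - I))"
    and H: "\<And>S. S \<in> H \<Longrightarrow> pairing I n a S = 0" and Y: "Y \<in> tensor_space_prod I (X - I) n H K"
  shows "pairing X n c Y = 0"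
proof -
  have "F2.subspace {Y. pairing X n c Y = 0}"
    by (auto simp: F2.subspace_def pairing_add pairing_bscale pairing_0)
  moreover have "pairing X n c Z = 0" if "Z \<in> {tensor_prod I (X - I) n S T | S T. S \<in> H \<and> T \<in> K}" for Z
  proof -
    from that obtain S T where Z: "Z = tensor_prod I (X - I) n S T" "S \<in> H" by blast
    have "I \<union> (X - I) = X" using I by blast
    then have "pairing X n c Z = (\<Sum>x\<in>indices X n. (a (restrict x I) * S (restrict x I)) * (b (restrict x (X - I)) * T (restrict x (X - I))))"
      unfolding pairing_def Z tensor_prod_def by (intro sum.cong refl) (simp add: c mult_ac)
    also have "\<dots> = pairing I n a S * pairing (X - I) n b T"
      unfolding sum_indices_split[OF I, of "\<lambda>y z. (a y * S y) * (b z * T z)"] pairing_def sum_product ..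
    finally show ?thesis using H[OF Z(2)] by simp
  qed
  ultimately show ?thesis
    using F2.span_subspace_induct[of Y "{tensor_prod I (X - I) n S T | S T. S \<in> H \<and> T \<in> K}" "{Y. pairing X n c Y = 0}"] Y
    unfolding tensor_space_prod_def by blast
qed

lemma tensor_space_prod_subset:
  assumes "I \<subseteq> X"
  shows "tensor_space_prod I (X - I) n H K \<subseteq> tensors X n"
  unfolding tensor_space_prod_def
proof (rule F2.span_minimal[OF _ subspace_tensors])
  have "I \<union> (X - I) = X" using assms by blast
  then show "{tensor_prod I (X - I) n S T |S T. S \<in> H \<and> T \<in> K} \<subseteq> tensors X n"
    by (auto simp: tensor_prod_def tensors_def)
qed

lemma pairing_pure_tensor:
  "pairing X n b (pure_tensor X n u) = (\<Sum>x\<in>indices X n. b x * (\<Prod>i\<in>X. u i (x i)))"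
  unfolding pairing_def pure_tensor_def by (intro sum.cong refl) simp

lemma mform_pairing:
  assumes X: "finite X"
  shows "mform X (\<lambda>u. pairing X n b (pure_tensor X n u))"
  unfolding mform_def pairing_pure_tensor
proof (intro conjI allI impI ballI)
  fix u v :: "nat \<Rightarrow> nat \<Rightarrow> bit" assume "\<forall>i\<in>X. u i = v i"
  then show "(\<Sum>x\<in>indices X n. b x * (\<Prod>i\<in>X. u i (x i))) = (\<Sum>x\<in>indices X n. b x * (\<Prod>i\<in>X. v i (x i)))" by simp
next
  fix i and u :: "nat \<Rightarrow> nat \<Rightarrow> bit" and v w assume i: "i \<in> X"
  have P: "(\<Prod>j\<in>X. (u(i := e)) j (x j)) = e (x i) * (\<Prod>j\<in>X - {i}. u j (x j))" for e x
    using prod.remove[OF X i, of "\<lambda>j. (u(i := e)) j (x j)"] by simp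
  show "(\<Sum>x\<in>indices X n. b x * (\<Prod>j\<in>X. (u(i := v + w)) j (x j))) =
    (\<Sum>x\<in>indices X n. b x * (\<Prod>j\<in>X. (u(i := v)) j (x j))) + (\<Sum>x\<in>indices X n. b x * (\<Prod>j\<in>X. (u(i := w)) j (x j)))"
    unfolding P by (simp add: distrib_left distrib_right sum.distrib)
qed

lemma pairing_unit_vecs:
  assumes X: "finite X" and x: "x \<in> indices X n" and u: "\<And>i. i \<in> X \<Longrightarrow> u i = unit_vec (x i)"
  shows "pairing X n b (pure_tensor X n u) = b x"
proof -
  have "(\<Prod>i\<in>X. u i (y i)) = (if y = x then 1 else 0)" if y: "y \<in> indices X n" for y
  proof (cases "y = x")
    case True
    then show ?thesis using u by (simp add: unit_vec_def)
  next
    case False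
    then obtain i where i: "i \<in> X" "y i \<noteq> x i" using x y by (metis indices_def PiE_ext)
    then have "u i (y i) = 0" using u by (simp add: unit_vec_def)
    then show ?thesis using i X False by (auto intro!: prod_zero)
  qed
  then have "pairing X n b (pure_tensor X n u) = (\<Sum>y\<in>indices X n. if y = x then b x else 0)"
    unfolding pairing_pure_tensor by (intro sum.cong refl) auto
  then show ?thesis using x finite_indices[OF X] by simp
qed

text \<open>As V is a subspace, adding a pure tensor keeps A in V exactly when the pure tensor lies
  in V, so A drops out. Allowing zero vectors as well turns each coordinate into a group and at most
  doubles its number of choices, whence \<open>2 ^ d\<close>.\<close>

lemma eta_closed_density:
  assumes V: "V \<subseteq> tensors {1..d} n" "F2.subspace V" and n: "\<And>i. i \<in> {1..d} \<Longrightarrow> n i \<ge> 1" and \<eta>: "eta_closed \<eta> d n V" "\<eta> > 0"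
  shows "\<eta> / 2 ^ d \<le> avg (\<Pi>\<^sub>E i\<in>{1..d}. vecs (n i)) (\<lambda>u. of_bool (pure_tensor {1..d} n u \<in> V))"
proof -
  let ?X = "{1..d}"
  let ?D = "PiE_dflt ?X 0 (\<lambda>i. vecs (n i) - {0})" and ?\<Omega> = "\<Pi>\<^sub>E i\<in>?X. vecs (n i)"
  let ?P = "\<lambda>u. pure_tensor ?X n u \<in> V"
  have fV: "finite V" "V \<noteq> {}"
    using finite_subset[OF V(1) finite_tensors] \<eta> by (simp, simp add: eta_closed_def)
  have vecs0: "vecs (n i) - {0} \<noteq> {}" if "i \<in> ?X" for i
  proof -
    have "unit_vec 0 \<in> vecs (n i) - {0}" using n[OF that] by (auto simp: vecs_def unit_vec_def fun_eq_iff)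
    then show ?thesis by blast
  qed
  have fv: "finite (vecs (n i) - {0})" for i using finite_vecs by simp
  have D: "finite ?D" "?D \<noteq> {}" using fv vecs0 by (auto intro!: finite_PiE_dflt)
  let ?q = "Pi_pmf ?X 0 (\<lambda>i. pmf_of_set (vecs (n i) - {0}))"
  have q: "?q = pmf_of_set ?D" using vecs0 fv by (intro Pi_pmf_of_set) auto
  have "\<eta> \<le> measure_pmf.prob (pair_pmf (pmf_of_set V) ?q) {(A, u). A + pure_tensor ?X n u \<in> V}"
    using \<eta>(1) by (simp add: eta_closed_def)
  also have "\<dots> = measure_pmf.prob (pair_pmf (pmf_of_set V) ?q) (snd -` {u. ?P u})"
  proof (rule measure_pmf.finite_measure_eq_AE)
    show "AE x in measure_pmf (pair_pmf (pmf_of_set V) ?q). (x \<in> {(A, u). A + pure_tensor ?X n u \<in> V}) = (x \<in> snd -` {u. ?P u})"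
      unfolding AE_measure_pmf_iff
    proof
      fix x assume "x \<in> set_pmf (pair_pmf (pmf_of_set V) ?q)"
      then obtain A u where x: "x = (A, u)" "A \<in> V" using fV by (auto simp: set_pmf_of_set)
      have "A + pure_tensor ?X n u \<in> V \<longleftrightarrow> ?P u"
      proof
        assume "A + pure_tensor ?X n u \<in> V"
        then have "A + (A + pure_tensor ?X n u) \<in> V" by (rule F2.subspace_add[OF V(2) x(2)])
        moreover have "A + (A + pure_tensor ?X n u) = pure_tensor ?X n u" by (simp add: fun_eq_iff)
        ultimately show "?P u" by simp
      qed (use x V(2) in \<open>simp add: F2.subspace_add\<close>)
      then show "(x \<in> {(A, u). A + pure_tensor ?X n u \<in> V}) = (x \<in> snd -` {u. ?P u})" using x by simp
    qed
  qed auto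
  also have "\<dots> = measure_pmf.prob (map_pmf snd (pair_pmf (pmf_of_set V) ?q)) {u. ?P u}"
    by simp
  also have "\<dots> = real (card (?D \<inter> {u. ?P u})) / real (card ?D)"
    unfolding map_snd_pair_pmf q by (rule measure_pmf_of_set[OF D(2,1)])
  finally have 1: "\<eta> * real (card ?D) \<le> real (card (?D \<inter> {u. ?P u}))"
    using D by (simp add: le_divide_eq card_gt_0_iff)
  have f\<Omega>: "finite ?\<Omega>" by (intro finite_PiE) (auto simp: finite_vecs)
  have "card ?\<Omega> = (\<Prod>i\<in>?X. card (vecs (n i)))" by (simp add: card_PiE)
  also have "\<dots> \<le> (\<Prod>i\<in>?X. 2 * card (vecs (n i) - {0}))"
  proof (rule prod_mono, rule conjI)
    fix i assume i: "i \<in> ?X"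
    have "0 < card (vecs (n i) - {0})" using vecs0[OF i] fv by (simp add: card_gt_0_iff)
    moreover have "card (vecs (n i)) \<le> card (vecs (n i) - {0}) + 1"
      using card_Diff1_le[of "vecs (n i)" 0] finite_vecs by (simp add: card_Diff_singleton_if split: if_splits)
    ultimately show "card (vecs (n i)) \<le> 2 * card (vecs (n i) - {0})" by linarith
  qed simp
  also have "\<dots> = 2 ^ d * card ?D" using fv by (simp add: prod.distrib card_PiE_dflt)
  finally have 2: "real (card ?\<Omega>) \<le> 2 ^ d * real (card ?D)"
    by (metis of_nat_le_iff of_nat_mult of_nat_numeral of_nat_power)
  have 3: "card (?D \<inter> {u. ?P u}) \<le> card (?\<Omega> \<inter> {u. ?P u})"
  \<comment> \<open>The two function spaces differ in the default outside {1..d}: 0 for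
    \<open>PiE_dflt\<close>, \<open>undefined\<close> for \<open>PiE\<close>;
    \<open>restrict\<close> translates.\<close>
  proof (rule card_inj_on_le[where f = "\<lambda>u. restrict u ?X"])
    show "inj_on (\<lambda>u. restrict u ?X) (?D \<inter> {u. ?P u})"
    proof (rule inj_onI)
      fix u v assume u: "u \<in> ?D \<inter> {u. ?P u}" and v: "v \<in> ?D \<inter> {u. ?P u}" and eq: "restrict u ?X = restrict v ?X"
      show "u = v"
      proof
        fix i show "u i = v i"
          using u v fun_cong[OF eq, of i] by (cases "i \<in> ?X") (auto simp: PiE_dflt_def)
      qed
    qed
    have "pure_tensor ?X n (restrict u ?X) = pure_tensor ?X n u" for u
      by (auto simp: pure_tensor_def fun_eq_iff intro!: prod.cong)
    then show "(\<lambda>u. restrict u ?X) ` (?D \<inter> {u. ?P u}) \<subseteq> ?\<Omega> \<inter> {u. ?P u}"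
      by (auto simp: PiE_dflt_def)
    show "finite (?\<Omega> \<inter> {u. ?P u})" using f\<Omega> by simp
  qed
  have "0 < card ?\<Omega>" using f\<Omega> by (auto simp: card_gt_0_iff PiE_eq_empty_iff vecs_def intro!: exI[of _ 0])
  have "\<eta> / 2 ^ d * real (card ?\<Omega>) \<le> \<eta> * real (card ?D)"
    using mult_left_mono[OF 2, of "\<eta> / 2 ^ d"] \<eta>(2) by simp
  also have "\<dots> \<le> real (card (?\<Omega> \<inter> {u. ?P u}))" using 1 3 by linarith
  finally show ?thesis
    using \<open>0 < card ?\<Omega>\<close> f\<Omega> by (simp add: avg_def le_divide_eq)
qed

text \<open>Evaluating T at unit vectors recovers the coordinates of each annihilator
  \<open>bs l\<close> and turns the decomposition of T into a sum of product tensors. A tensor in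
  all spaces of the family pairs to 0 with each product, hence with every annihilator of V, and so
  lies in V.\<close>

lemma closed_subspace_contains_simple:
  assumes rank: "\<And>(E :: nat \<Rightarrow> (nat \<Rightarrow> bit) set) J T. coord_groups E \<Longrightarrow> finite J \<Longrightarrow> J \<noteq> {} \<Longrightarrow> card J = d + 1 \<Longrightarrow>
      mform J T \<Longrightarrow> \<eta> / 2 ^ d \<le> coord_groups.bias E J T \<Longrightarrow> coord_groups.partition_rank_le E J T k"
    and d: "d \<ge> 1" and \<eta>: "\<eta> > 0" "eta_closed \<eta> d n V" and n: "\<And>i. i \<in> {1..d} \<Longrightarrow> n i \<ge> 1"
    and V: "V \<subseteq> tensors {1..d} n" "F2.subspace V"
  shows "\<exists>H. codim_family k d n H \<and> family_inter d n H \<subseteq> V"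
proof -
  define X where "X = {1..d}"
  define J where "J = insert 0 X"
  define U where "U = {b \<in> tensors X n. \<forall>A\<in>V. pairing X n b A = 0}"
  have X: "finite X" "0 \<notin> X" "X \<noteq> {}" using d by (auto simp: X_def)
  have "finite U" unfolding U_def using finite_tensors[OF X(1)] by simp
  then obtain m and bs :: "nat \<Rightarrow> tensor" where U: "U = bs ` {..<m}"
    using finite_imp_nat_seg_image_inj_on[of U] by (auto simp: lessThan_def)
  \<comment> \<open>The index 0 is free because the tensor factors are numbered from 1. Its group is
    F_2^m; m may be arbitrarily large, as k is uniform in the groups.\<close>
  define E where "E = (\<lambda>i. if i = 0 then vecs m else vecs (n i))"
  define T where "T = (\<lambda>u :: nat \<Rightarrow> nat \<Rightarrow> bit. \<Sum>l<m. u 0 l * pairing X n (bs l) (pure_tensor X n u))"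
  have E: "coord_groups E"
  proof
    show "finite (E i)" for i by (simp add: E_def finite_vecs)
  qed (auto simp: E_def vecs_def split: if_splits)
  interpret coord_groups E by (rule E)
  have T: "mform J T"
    unfolding mform_def
  proof (intro conjI allI impI ballI)
    fix u v :: "nat \<Rightarrow> nat \<Rightarrow> bit" assume eq: "\<forall>i\<in>J. u i = v i"
    have "pairing X n b (pure_tensor X n u) = pairing X n b (pure_tensor X n v)" for b
      by (rule mform_cong[OF mform_pairing[OF X(1)]]) (use eq in \<open>simp add: J_def\<close>)
    then show "T u = T v" using eq by (simp add: T_def J_def)
  next
    fix i and u :: "nat \<Rightarrow> nat \<Rightarrow> bit" and v w assume i: "i \<in> J"
    let ?ev = "\<lambda>b u. pairing X n b (pure_tensor X n u)"
    show "T (u(i := v + w)) = T (u(i := v)) + T (u(i := w))"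
    proof (cases "i = 0")
      case True
      have "?ev b (u(0 := e)) = ?ev b u" for b e
        by (rule mform_cong[OF mform_pairing[OF X(1)]]) (use X(2) in auto)
      then show ?thesis unfolding T_def True by (simp add: distrib_right sum.distrib)
    next
      case False
      then have "?ev b (u(i := v + w)) = ?ev b (u(i := v)) + ?ev b (u(i := w))" for b
        using i by (intro mform_add[OF mform_pairing[OF X(1)]]) (simp add: J_def)
      then show ?thesis using False unfolding T_def by (simp add: distrib_left sum.distrib)
    qed
  qed
  have bias: "\<eta> / 2 ^ d \<le> bias J T"
  proof -
    have \<Omega>: "PiE X E = (\<Pi>\<^sub>E i\<in>{1..d}. vecs (n i))"
      unfolding X_def by (rule PiE_cong) (auto simp: E_def)
    have "avg (PiE X E) (\<lambda>u. of_bool (pure_tensor X n u \<in> V))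
      \<le> avg (PiE X E) (\<lambda>w. avg (E 0) (\<lambda>a. sg (T (w(0 := a)))))"
    proof (rule avg_mono)
      fix w
      have "T (w(0 := a + b)) = T (w(0 := a)) + T (w(0 := b))" for a b
        by (rule mform_add[OF T]) (simp add: J_def)
      then have *: "avg (E 0) (\<lambda>a. sg (T (w(0 := a)))) = (if \<forall>a\<in>E 0. T (w(0 := a)) = 0 then 1 else 0)"
        by (rule avg_character)
      have "T (w(0 := a)) = 0" if "pure_tensor X n w \<in> V" for a
      proof -
        have "pairing X n (bs l) (pure_tensor X n (w(0 := a))) = 0" if "l < m" for l
        proof -
          have "pairing X n (bs l) (pure_tensor X n (w(0 := a))) = pairing X n (bs l) (pure_tensor X n w)"
            by (rule mform_cong[OF mform_pairing[OF X(1)]]) (use X(2) in auto)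
          moreover have "bs l \<in> U" using U that by blast
          ultimately show ?thesis using \<open>pure_tensor X n w \<in> V\<close> by (simp add: U_def)
        qed
        then show ?thesis by (simp add: T_def)
      qed
      then show "of_bool (pure_tensor X n w \<in> V) \<le> avg (E 0) (\<lambda>a. sg (T (w(0 := a))))"
        unfolding * by auto
    qed
    also have "\<dots> = bias J T"
      unfolding bias_def J_def avg_PiE_insert[OF X(2,1)] by (rule avg_swap)
    finally show ?thesis
      using eta_closed_density[OF V n \<eta>(2,1)] unfolding \<Omega> by (simp add: X_def)
  qed
  have "card J = d + 1" using X by (simp add: J_def) (simp add: X_def)
  then have "partition_rank_le J T k"
    by (intro rank[OF E _ _ _ T bias]) (use X in \<open>auto simp: J_def\<close>)
  then obtain R where R: "finite R" "card R \<le> k"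
    and R1: "\<forall>(I, f, g)\<in>R. I \<subset> J \<and> I \<noteq> {} \<and> mform I f \<and> mform (J - I) g"
    and R2: "\<forall>x\<in>PiE J E. T x = (\<Sum>(I, f, g)\<in>R. f x * g x)"
    unfolding partition_rank_le_def by (elim exE conjE)
  \<comment> \<open>Exactly one factor of each product avoids variable 0: \<open>ka r\<close>, of
    type \<open>ty r\<close>, while \<open>fo r\<close> is the cofactor. Only \<open>ka r\<close>
    may define a subspace, since it does not depend on l.\<close>
  define ty where "ty = (\<lambda>r :: nat set \<times> ((nat \<Rightarrow> nat \<Rightarrow> bit) \<Rightarrow> bit) \<times> ((nat \<Rightarrow> nat \<Rightarrow> bit) \<Rightarrow> bit).
    if 0 \<in> fst r then J - fst r else fst r)"
  define ka where "ka = (\<lambda>r :: nat set \<times> ((nat \<Rightarrow> nat \<Rightarrow> bit) \<Rightarrow> bit) \<times> ((nat \<Rightarrow> nat \<Rightarrow> bit) \<Rightarrow> bit).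
    if 0 \<in> fst r then snd (snd r) else fst (snd r))"
  define fo where "fo = (\<lambda>r :: nat set \<times> ((nat \<Rightarrow> nat \<Rightarrow> bit) \<Rightarrow> bit) \<times> ((nat \<Rightarrow> nat \<Rightarrow> bit) \<Rightarrow> bit).
    if 0 \<in> fst r then fst (snd r) else snd (snd r))"
  have ty: "ty r \<subseteq> X \<and> ty r \<noteq> {} \<and> mform (ty r) (ka r) \<and> mform (J - ty r) (fo r)" if r: "r \<in> R" for r
  proof -
    have *: "fst r \<subset> J" "fst r \<noteq> {}" "mform (fst r) (fst (snd r))" "mform (J - fst r) (snd (snd r))"
      using bspec[OF R1 r] by (auto simp: split_beta)
    show ?thesis
    proof (cases "0 \<in> fst r")
      case True
      then have "J - (J - fst r) = fst r" using * by blast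
      then show ?thesis using * True unfolding ty_def ka_def fo_def by (auto simp: J_def)
    next
      case False
      then show ?thesis using * unfolding ty_def ka_def fo_def by (auto simp: J_def)
    qed
  qed
  have T_eq: "T u = (\<Sum>r\<in>R. ka r u * fo r u)" if "u \<in> PiE J E" for u
    unfolding bspec[OF R2 that] by (intro sum.cong refl) (auto simp: ka_def fo_def split_beta mult.commute)
  define pt where "pt = (\<lambda>x :: nat \<Rightarrow> nat. \<lambda>i. unit_vec (x i) :: nat \<Rightarrow> bit)"
  define H where "H = (\<lambda>I. {S \<in> tensors I n. \<forall>r\<in>{r \<in> R. ty r = I}. pairing I n (\<lambda>x. ka r (pt x)) S = 0})"
  have "codim_family k d n H"
    unfolding codim_family_def
  proof (intro allI impI conjI)
    fix I assume I: "I \<subseteq> {1..d} \<and> I \<noteq> {}"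
    show "F2.subspace (H I)" unfolding H_def by (rule subspace_annihilator)
    show "H I \<subseteq> tensors I n" by (auto simp: H_def)
    have "finite I" using I finite_subset by auto
    then have "F2.dim (tensors I n) \<le> F2.dim (H I) + card {r \<in> R. ty r = I}"
      unfolding H_def by (rule dim_annihilator) (use R in auto)
    also have "card {r \<in> R. ty r = I} \<le> k" using R card_mono[of R "{r \<in> R. ty r = I}"] by auto
    finally show "F2.dim (tensors I n) - F2.dim (H I) \<le> k" by simp
  qed
  moreover have "family_inter d n H \<subseteq> V"
  proof
    fix Y assume Y: "Y \<in> family_inter d n H"
    have Y_in: "Y \<in> tensor_space_prod I (X - I) n (H I) (tensors (X - I) n)" if "I \<subseteq> X" "I \<noteq> {}" for I
      using Y that unfolding family_inter_def X_def by blast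
    have YX: "Y \<in> tensors X n"
      using Y_in[OF subset_refl X(3)] tensor_space_prod_subset[OF subset_refl] by blast
    have "pairing X n (bs l) Y = 0" if l: "l < m" for l
    proof -
      \<comment> \<open>Setting u_0 to the l-th unit vector singles out \<open>bs l\<close>;
        \<open>restrict\<close> is required because the decomposition of T holds only on
        \<open>PiE J E\<close>.\<close>
      define ul where "ul = (\<lambda>x. restrict ((pt x)(0 := unit_vec l)) J)"
      have ul: "ul x \<in> PiE J E" if x: "x \<in> indices X n" for x
      proof (rule PiE_I)
        fix i assume i: "i \<in> J"
        show "ul x i \<in> E i"
        proof (cases "i = 0")
          case True
          then show ?thesis using l i by (auto simp: ul_def E_def vecs_def unit_vec_def)
        next
          case False
          then have "x i < n i" using x i by (auto simp: indices_def J_def PiE_def Pi_def)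
          then show ?thesis using False i by (auto simp: ul_def E_def vecs_def unit_vec_def pt_def)
        qed
      qed (simp add: ul_def)
      have T_ul: "T (ul x) = bs l x" if x: "x \<in> indices X n" for x
      proof -
        have "pairing X n b (pure_tensor X n (ul x)) = b x" for b
          by (rule pairing_unit_vecs[OF X(1) x]) (use X(2) in \<open>auto simp: ul_def J_def pt_def\<close>)
        then have "T (ul x) = (\<Sum>j<m. if j = l then bs l x else 0)"
          unfolding T_def by (intro sum.cong refl) (auto simp: ul_def J_def unit_vec_def)
        then show ?thesis using l by simp
      qed
      have "pairing X n (bs l) Y = (\<Sum>x\<in>indices X n. (\<Sum>r\<in>R. ka r (ul x) * fo r (ul x)) * Y x)"
        unfolding pairing_def using T_ul T_eq[OF ul] by (intro sum.cong refl) simp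
      also have "\<dots> = (\<Sum>r\<in>R. pairing X n (\<lambda>x. ka r (ul x) * fo r (ul x)) Y)"
        unfolding pairing_def sum_distrib_right by (rule sum.swap)
      also have "\<dots> = 0"
      proof (rule sum.neutral, rule ballI)
        fix r assume r: "r \<in> R"
        show "pairing X n (\<lambda>x. ka r (ul x) * fo r (ul x)) Y = 0"
        proof (rule pairing_tensor_space_prod[where I = "ty r" and H = "H (ty r)"])
          show "ty r \<subseteq> X" using ty[OF r] by blast
          show "Y \<in> tensor_space_prod (ty r) (X - ty r) n (H (ty r)) (tensors (X - ty r) n)"
            using ty[OF r] by (intro Y_in) auto
          show "pairing (ty r) n (\<lambda>x. ka r (pt x)) S = 0" if "S \<in> H (ty r)" for S
            using that r unfolding H_def by blast
          fix x
          have t: "ty r \<subseteq> X" "mform (ty r) (ka r)" "mform (J - ty r) (fo r)" using ty[OF r] by blast+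
          have "ul x i = pt (restrict x (ty r)) i" if "i \<in> ty r" for i
          proof -
            have "i \<in> X" using that t(1) by blast
            then have "i \<noteq> 0" "i \<in> J" using X(2) by (metis, simp add: J_def)
            then show ?thesis using that by (simp add: ul_def pt_def)
          qed
          then have "ka r (ul x) = ka r (pt (restrict x (ty r)))" by (rule mform_cong[OF t(2)])
          moreover have "ul x i = ((pt (restrict x (X - ty r)))(0 := unit_vec l)) i" if "i \<in> J - ty r" for i
            using that by (auto simp: ul_def pt_def J_def)
          then have "fo r (ul x) = fo r ((pt (restrict x (X - ty r)))(0 := unit_vec l))" by (rule mform_cong[OF t(3)])
          ultimately show "ka r (ul x) * fo r (ul x) = ka r (pt (restrict x (ty r))) *
              (\<lambda>y. fo r ((pt y)(0 := unit_vec l))) (restrict x (X - ty r))" by simp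
        qed
      qed
      finally show ?thesis .
    qed
    then have "\<forall>b\<in>U. pairing X n b Y = 0" using U by auto
    then show "Y \<in> V"
      using exists_separating_tensor[OF X(1) V(2) V(1)[folded X_def] YX] unfolding U_def by force
  qed
  ultimately show ?thesis by blast
qed

theorem corollary1p12:
  fixes \<eta> :: real and d :: nat
  assumes "\<eta> > 0" and "d \<ge> 1"
  shows "\<exists>k::nat. \<forall>(n :: nat \<Rightarrow> nat) (V :: tensor set).
    (\<forall>i\<in>{1..d}. n i \<ge> 1) \<longrightarrow>
    V \<subseteq> tensors {1..d} n \<longrightarrow> F2.subspace V \<longrightarrow> eta_closed \<eta> d n V \<longrightarrow>
      (\<exists>W. W \<subseteq> V \<and> F2.subspace W \<and> k_simple k d n W) \<and>
      (\<exists>H. codim_family k d n H \<and> family_inter d n H \<subseteq> V)"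
proof -
  have "0 < \<eta> / 2 ^ d" using assms by simp
  from biased_form_partition_rank[OF this, of "d + 1"]
  obtain k where k: "\<forall>(E :: nat \<Rightarrow> (nat \<Rightarrow> bit) set) J T. coord_groups E \<longrightarrow> finite J \<longrightarrow> J \<noteq> {} \<longrightarrow> card J = d + 1 \<longrightarrow>
      mform J T \<longrightarrow> \<eta> / 2 ^ d \<le> coord_groups.bias E J T \<longrightarrow> coord_groups.partition_rank_le E J T k" ..
  show ?thesis
  proof (intro exI[of _ k] allI impI)
    fix n :: "nat \<Rightarrow> nat" and V :: "tensor set"
    assume n: "\<forall>i\<in>{1..d}. n i \<ge> 1" and V: "V \<subseteq> tensors {1..d} n" "F2.subspace V" and cl: "eta_closed \<eta> d n V"
    obtain H where H: "codim_family k d n H" "family_inter d n H \<subseteq> V"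
      using closed_subspace_contains_simple[OF k[rule_format] assms(2,1) cl n[rule_format] V] by blast
    have sub: "F2.subspace (family_inter d n H)"
      unfolding family_inter_def tensor_space_prod_def by (intro F2.subspace_Inter) auto
    have "k_simple k d n (family_inter d n H)"
      unfolding k_simple_def
    proof (intro exI[of _ H] bexI[of _ 0] conjI H(1))
      show "0 \<in> tensors {1..d} n" by (simp add: tensors_def)
    qed simp
    then show "(\<exists>W. W \<subseteq> V \<and> F2.subspace W \<and> k_simple k d n W) \<and>
      (\<exists>H. codim_family k d n H \<and> family_inter d n H \<subseteq> V)"
      using sub H by blast
  qed
qed

end
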